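(* Let $p\in(1,2]$ and let $\psi$ be a concave index function such that the variational source condition $$\langle f^*,f^\dagger-f\rangle\le \tfrac12\Delta_{\mathcal R}(f,f^\dagger)+\psi\big(\|F(f^\dagger)-F(f)\|_{\mathcal Y}^2\big)\qquad\text{for all } f\in\mathcal D$$ holds. Assume that there are constants $C_0,\beta,\gamma>0$ such that $$\|F(f_1)-F(f_2)\|_{B^{d/2}_{p,1}}\le C_0\,\|F(f_1)-F(f_2)\|_{L^2}^{\beta}\,\Delta_{\mathcal R}(f_1,f_2)^{\gamma}\qquad\text{for all } f_1,f_2\in\mathcal D .$$ Let $\alpha>0$ and let $\widehat f_\alpha$ be a global minimizer over $f\in\mathcal D$ of the Tikhonov functional $\tfrac12\|F(f)\|_{\mathcal Y}^2-\langle g^{\mathrm{obs}},F(f)\rangle+\alpha\mathcal R(f)$, where $g^{\mathrm{obs}}=g^\dagger+\varepsilon Z$. Then there is a constant $C>0$ (independent of $\alpha$, $\varepsilon$, $Z$ and $\widehat f_\alpha$) such that: (i) If $0<\beta<2$, then the effective noise level $\mathbf{err}(F(\widehat f_\alpha)):=\varepsilon\langle Z,F(\widehat f_\alpha)-g^\dagger\rangle$ satisfies $$\mathbf{err}(F(\widehat f_\alpha))\le C\,\|\varepsilon Z\|_{B^{-d/2}_{p',\infty}}^{\frac{2}{2-\beta}}\,\Delta_{\mathcal R}(\widehat f_\alpha,f^\dagger)^{\frac{2\gamma}{2-\beta}}+2\alpha\,\varphi_\psi(4\alpha).$$ (ii) If in addition $0<\gamma<\tfrac12(2-\beta)$, then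 $$\tfrac12\Delta_{\mathcal R}(\widehat f_\alpha,f^\dagger)\le C\,\alpha^{-\frac{2-\beta}{2-\beta-2\gamma}}\,\|\varepsilon Z\|_{B^{-d/2}_{p',\infty}}^{\frac{2}{2-\beta-2\gamma}}+4\,\varphi_\psi(4\alpha).$$
   Context: $\Omega$ is either a bounded Lipschitz domain in $\mathbb R^d$ or the torus $\mathbb T^d=\mathbb R^d/\mathbb Z^d$; $B^s_{p,q}$ are the Besov spaces on $\Omega$; $p'$ is the Hölder conjugate of $p$. $\mathcal X$ is a Besov space, $\mathcal Y=L^2(\Omega)$, $\mathcal D\subset\mathcal X$ is nonempty, closed and convex, $F:\mathcal D\to\mathcal Y$, $f^\dagger\in\mathcal D$, $g^\dagger=F(f^\dagger)$. $\mathcal R:\mathcal X\to(-\infty,\infty]$ is a convex, differentiable penalty functional, $f^*\in\partial\mathcal R(f^\dagger)$, and the Bregman distance is $\Delta_{\mathcal R}(f,h)=\mathcal R(f)-\mathcal R(h)-\langle h^*,f-h\rangle$ with $h^*\in\partial\mathcal R(h)$. The noise $Z$ is a random variable with values in the space of distributions $\mathscr D'(\Omega)$, $\varepsilon>0$ is the noise level; the inequalities are understood for each realization with $Z\in B^{-d/2}_{p',\infty}$, and $\langle Z,g\rangle$ is the duality pairing of $B^{-d/2}_{p',\infty}$ with $B^{d/2}_{p,1}$ (it is understood that $F(f)\in B^{d/2}_{p,1}$ for $f\in\mathcal D$, so that the Tikhonov functional is well defined). A concave index function is a function $\psi:[0,\infty)\to[0,\infty)$ that is concave, continuous, increasing,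 with $\psi(0)=0$. For such $\psi$ (extended by $-\infty$ to negative arguments), $\varphi_\psi(\tau):=(-\psi)^*(-1/\tau)=\sup_{u\ge0}\big[\psi(u)-u/\tau\big]$ for $\tau>0$. *)

theory Defs
  imports "HOL-Analysis.Analysis" "HOL-Probability.Probability_Measure"
begin

section \<open>Linear functionals and dual spaces\<close>

text \<open>
  Distributions, and functionals on spaces of functions or of distributions, are all HOL functions
  into the reals, so that a vector space is a set of such functions, with pointwise operations and
  an extended-valued norm \<open>nrm\<close> which is finite on the space. All spaces are over the reals.
\<close>

definition linear_functional_on :: "('b \<Rightarrow> real) set \<Rightarrow> (('b \<Rightarrow> real) \<Rightarrow> real) \<Rightarrow> bool" where
  "linear_functional_on V T \<longleftrightarrow>
     (\<forall>u\<in>V. \<forall>v\<in>V. \<forall>a b. T (\<lambda>x. a * u x + b * v x) = a * T u + b * T v)"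

definition dual_norm ::
  "('b \<Rightarrow> real) set \<Rightarrow> (('b \<Rightarrow> real) \<Rightarrow> ennreal) \<Rightarrow> (('b \<Rightarrow> real) \<Rightarrow> real) \<Rightarrow> ennreal" where
  "dual_norm V nrm \<xi> = Inf {K. \<forall>v\<in>V. ennreal \<bar>\<xi> v\<bar> \<le> K * nrm v}"

definition dual_space ::
  "('b \<Rightarrow> real) set \<Rightarrow> (('b \<Rightarrow> real) \<Rightarrow> ennreal) \<Rightarrow> (('b \<Rightarrow> real) \<Rightarrow> real) set" where
  "dual_space V nrm = {\<xi>. linear_functional_on V \<xi> \<and> dual_norm V nrm \<xi> < \<infinity>}"

section \<open>Regions\<close>

text \<open>
  The torus is \<open>\<real>\<^sup>d / \<int>\<^sup>d\<close>: smooth functions on it are \<open>\<int>\<^sup>d\<close>-periodic smooth functions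
  on \<open>\<real>\<^sup>d\<close>, while measurable functions on it are functions on the fundamental cell
  \<open>[0,1]\<^sup>d\<close> (their values outside the cell are irrelevant).
\<close>

datatype 'a region = Torus | Domain "'a set"

text \<open>
  Near each boundary point the domain lies strictly above the graph of a Lipschitz function \<open>h\<close> of
  the variables orthogonal to a unit vector \<open>e\<close>.
\<close>

definition bounded_Lipschitz_domain :: "(real^'n) set \<Rightarrow> bool" where
  "bounded_Lipschitz_domain U \<longleftrightarrow>
     U \<noteq> {} \<and> open U \<and> connected U \<and> bounded U \<and>
     (\<forall>x\<in>frontier U. \<exists>r>0. \<exists>e L. \<exists>h :: real^'n \<Rightarrow> real.
        norm e = 1 \<and> L-lipschitz_on UNIV h \<and>
        U \<inter> ball x r = {y \<in> ball x r. h (y - (e \<bullet> y) *\<^sub>R e) < e \<bullet> y})"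

fun admissible :: "(real^'n) region \<Rightarrow> bool" where
  "admissible Torus = True"
| "admissible (Domain U) = bounded_Lipschitz_domain U"

fun region_measure :: "(real^'n) region \<Rightarrow> (real^'n) measure" where
  "region_measure Torus = lebesgue_on (cbox 0 One)"
| "region_measure (Domain U) = lebesgue_on U"

section \<open>Test functions and distributions\<close>

type_synonym 'n distr = "(real^'n \<Rightarrow> real) \<Rightarrow> real"

fun iter_deriv :: "(real^'n) list \<Rightarrow> (real^'n \<Rightarrow> real) \<Rightarrow> real^'n \<Rightarrow> real" where
  "iter_deriv [] f = f"
| "iter_deriv (v # vs) f = (\<lambda>x. frechet_derivative (iter_deriv vs f) (at x) v)"

definition smooth :: "(real^'n \<Rightarrow> real) \<Rightarrow> bool" where
  "smooth f \<longleftrightarrow> (\<forall>vs\<in>lists Basis. iter_deriv vs f differentiable_on UNIV)"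

definition integer_lattice :: "(real^'n) set" where
  "integer_lattice = {k. \<forall>i. k $ i \<in> \<int>}"

definition supp :: "(real^'n \<Rightarrow> real) \<Rightarrow> (real^'n) set" where
  "supp f = closure {x. f x \<noteq> 0}"

fun test_functions :: "(real^'n) region \<Rightarrow> (real^'n \<Rightarrow> real) set" where
  "test_functions Torus = {\<phi>. smooth \<phi> \<and> (\<forall>k\<in>integer_lattice. \<forall>x. \<phi> (x + k) = \<phi> x)}"
| "test_functions (Domain U) = {\<phi>. smooth \<phi> \<and> compact (supp \<phi>) \<and> supp \<phi> \<subseteq> U}"

text \<open>
  Continuity is expressed by seminorm estimates; \<open>B\<close> ranges over the upper bounds of the seminorm.
\<close>

fun continuous_on_tests :: "(real^'n) region \<Rightarrow> 'n distr \<Rightarrow> bool" where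
  "continuous_on_tests Torus T \<longleftrightarrow>
     (\<exists>C N. \<forall>\<phi>\<in>test_functions Torus. \<forall>B.
        (\<forall>vs\<in>lists Basis. length vs \<le> N \<longrightarrow> (\<forall>x. \<bar>iter_deriv vs \<phi> x\<bar> \<le> B)) \<longrightarrow> \<bar>T \<phi>\<bar> \<le> C * B)"
| "continuous_on_tests (Domain U) T \<longleftrightarrow>
     (\<forall>K. compact K \<and> K \<subseteq> U \<longrightarrow>
       (\<exists>C N. \<forall>\<phi>\<in>test_functions (Domain U). supp \<phi> \<subseteq> K \<longrightarrow> (\<forall>B.
         (\<forall>vs\<in>lists Basis. length vs \<le> N \<longrightarrow> (\<forall>x. \<bar>iter_deriv vs \<phi> x\<bar> \<le> B)) \<longrightarrow> \<bar>T \<phi>\<bar> \<le> C * B)))"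

definition restrict_tests :: "(real^'n) region \<Rightarrow> 'n distr \<Rightarrow> 'n distr" where
  "restrict_tests \<Omega> T = (\<lambda>\<phi>. if \<phi> \<in> test_functions \<Omega> then T \<phi> else 0)"

text \<open>
  Distributions vanish by convention off the test functions, so that HOL equality of distributions
  is equality in \<open>\<D>'(\<Omega>)\<close>.
\<close>

definition distributions :: "(real^'n) region \<Rightarrow> 'n distr set" where
  "distributions \<Omega> =
     {T. linear_functional_on (test_functions \<Omega>) T \<and> continuous_on_tests \<Omega> T \<and> restrict_tests \<Omega> T = T}"

definition regular_distr :: "(real^'n) region \<Rightarrow> (real^'n \<Rightarrow> real) \<Rightarrow> 'n distr" where
  "regular_distr \<Omega> g =
     restrict_tests \<Omega> (\<lambda>\<phi>. integral\<^sup>L (region_measure \<Omega>) (\<lambda>x. g x * \<phi> x))"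

definition schwartz :: "(real^'n \<Rightarrow> real) set" where
  "schwartz = {\<phi>. smooth \<phi> \<and>
     (\<forall>vs\<in>lists Basis. \<forall>m. \<exists>B. \<forall>x. (1 + norm x) ^ m * \<bar>iter_deriv vs \<phi> x\<bar> \<le> B)}"

definition tempered :: "'n::finite distr set" where
  "tempered = {T. linear_functional_on schwartz T \<and>
     (\<exists>C N. \<forall>\<phi>\<in>schwartz. \<forall>B.
        (\<forall>vs\<in>lists Basis. length vs \<le> N \<longrightarrow> (\<forall>x. (1 + norm x) ^ N * \<bar>iter_deriv vs \<phi> x\<bar> \<le> B))
          \<longrightarrow> \<bar>T \<phi>\<bar> \<le> C * B)}"

section \<open>Lebesgue norms\<close>

definition epowr :: "ennreal \<Rightarrow> real \<Rightarrow> ennreal" where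
  "epowr a r = (if a = \<infinity> then \<infinity> else ennreal (enn2real a powr r))"

definition elp_norm :: "'b measure \<Rightarrow> ennreal \<Rightarrow> ('b \<Rightarrow> ennreal) \<Rightarrow> ennreal" where
  "elp_norm M p f =
     (if p = \<infinity> then Inf {C. AE x in M. f x \<le> C}
      else epowr (\<integral>\<^sup>+ x. epowr (f x) (enn2real p) \<partial>M) (1 / enn2real p))"

definition lp_norm :: "'b measure \<Rightarrow> ennreal \<Rightarrow> ('b \<Rightarrow> real) \<Rightarrow> ennreal" where
  "lp_norm M p f =
     (if f \<in> borel_measurable M then elp_norm M p (\<lambda>x. ennreal \<bar>f x\<bar>) else \<infinity>)"

definition L2_space :: "(real^'n) region \<Rightarrow> (real^'n \<Rightarrow> real) set" where
  "L2_space \<Omega> = {g \<in> borel_measurable (region_measure \<Omega>). integrable (region_measure \<Omega>) (\<lambda>x. (g x)\<^sup>2)}"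

definition L2_inner :: "(real^'n) region \<Rightarrow> (real^'n \<Rightarrow> real) \<Rightarrow> (real^'n \<Rightarrow> real) \<Rightarrow> real" where
  "L2_inner \<Omega> g h = integral\<^sup>L (region_measure \<Omega>) (\<lambda>x. g x * h x)"

definition L2_nrm :: "(real^'n) region \<Rightarrow> (real^'n \<Rightarrow> real) \<Rightarrow> real" where
  "L2_nrm \<Omega> g = sqrt (L2_inner \<Omega> g g)"

section \<open>Besov spaces\<close>

text \<open>
  A smooth radial cut-off, equal to 1 for \<open>\<bar>\<xi>\<bar> \<le> 1\<close> and to 0 for \<open>\<bar>\<xi>\<bar> \<ge> 2\<close>, and the dyadic resolution
  of unity generated by it: \<open>dyadic j\<close> vanishes outside \<open>2\<^sup>j\<^sup>-\<^sup>1 < \<bar>\<xi>\<bar> < 2\<^sup>j\<^sup>+\<^sup>1\<close> for \<open>j \<ge> 1\<close>.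
  Other choices lead to equivalent norms.
\<close>

definition flat_exp :: "real \<Rightarrow> real" where
  "flat_exp t = (if t > 0 then exp (- 1 / t) else 0)"

definition cutoff :: "real^'n \<Rightarrow> real" where
  "cutoff \<xi> = flat_exp (2 - norm \<xi>) / (flat_exp (2 - norm \<xi>) + flat_exp (norm \<xi> - 1))"

fun dyadic :: "nat \<Rightarrow> real^'n \<Rightarrow> real" where
  "dyadic 0 \<xi> = cutoff \<xi>"
| "dyadic (Suc j) \<xi> = cutoff (\<xi> /\<^sub>R 2 ^ Suc j) - cutoff (\<xi> /\<^sub>R 2 ^ j)"

text \<open>
  On \<open>\<real>\<^sup>d\<close>, the block \<open>\<F>\<inverse>(dyadic j \<cdot> \<F>T)\<close> is the convolution of \<open>T\<close> with the inverse Fourier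
  transform of \<open>dyadic j\<close>, which is real since \<open>dyadic j\<close> is even. On the torus, the block is
  \<open>\<Sum>\<^sub>k dyadic j k \<cdot> T(e\<^sup>-\<^sup>2\<^sup>\<pi>\<^sup>i\<^sup>k\<^sup>\<cdot>) e\<^sup>2\<^sup>\<pi>\<^sup>i\<^sup>k\<^sup>x\<close>, a finite sum, whose imaginary part cancels for the same reason.
\<close>

definition dyadic_kernel :: "nat \<Rightarrow> real^'n \<Rightarrow> real" where
  "dyadic_kernel j x = integral\<^sup>L lborel (\<lambda>\<xi>. dyadic j \<xi> * cos (2 * pi * (\<xi> \<bullet> x)))"

definition block_space :: "nat \<Rightarrow> 'n::finite distr \<Rightarrow> real^'n \<Rightarrow> real" where
  "block_space j T x = T (\<lambda>y. dyadic_kernel j (x - y))"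

definition block_torus :: "nat \<Rightarrow> 'n::finite distr \<Rightarrow> real^'n \<Rightarrow> real" where
  "block_torus j T x =
     (\<Sum>k \<in> {k \<in> integer_lattice. dyadic j k \<noteq> 0}. dyadic j k *
        (T (\<lambda>y. cos (2 * pi * (k \<bullet> y))) * cos (2 * pi * (k \<bullet> x)) +
         T (\<lambda>y. sin (2 * pi * (k \<bullet> y))) * sin (2 * pi * (k \<bullet> x))))"

definition besov_sequence_norm ::
  "(real^'n) measure \<Rightarrow> real \<Rightarrow> ennreal \<Rightarrow> ennreal \<Rightarrow> (nat \<Rightarrow> real^'n \<Rightarrow> real) \<Rightarrow> ennreal" where
  "besov_sequence_norm M s p q b =
     elp_norm (count_space UNIV) q (\<lambda>j. ennreal (2 powr (real j * s)) * lp_norm M p (b j))"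

definition besov_norm_space :: "real \<Rightarrow> ennreal \<Rightarrow> ennreal \<Rightarrow> 'n::finite distr \<Rightarrow> ennreal" where
  "besov_norm_space s p q T = besov_sequence_norm lebesgue s p q (\<lambda>j. block_space j T)"

text \<open>
  On a domain, \<open>B\<^sup>s\<^sub>p\<^sub>q\<close> consists of the restrictions of elements of \<open>B\<^sup>s\<^sub>p\<^sub>q(\<real>\<^sup>d)\<close>, with the quotient norm;
  the norm is infinite if there is no tempered extension at all.
\<close>

fun besov_norm :: "(real^'n) region \<Rightarrow> real \<Rightarrow> ennreal \<Rightarrow> ennreal \<Rightarrow> 'n distr \<Rightarrow> ennreal" where
  "besov_norm Torus s p q T =
     besov_sequence_norm (region_measure Torus) s p q (\<lambda>j. block_torus j T)"
| "besov_norm (Domain U) s p q T =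
     Inf (besov_norm_space s p q ` {S \<in> tempered. restrict_tests (Domain U) S = T})"

definition besov :: "(real^'n) region \<Rightarrow> real \<Rightarrow> ennreal \<Rightarrow> ennreal \<Rightarrow> 'n distr set" where
  "besov \<Omega> s p q = {T \<in> distributions \<Omega>. besov_norm \<Omega> s p q T < \<infinity>}"

text \<open>
  The space \<open>B\<^sup>d\<^sup>/\<^sup>2\<^sub>p\<^sub>,\<^sub>1(\<Omega>)\<close> as a space of functions. It is contained in the bounded continuous
  functions, so working inside \<open>L\<^sup>2\<close> is no restriction.
\<close>

definition Bd2_norm :: "(real^'n) region \<Rightarrow> real \<Rightarrow> (real^'n \<Rightarrow> real) \<Rightarrow> ennreal" where
  "Bd2_norm \<Omega> p g = besov_norm \<Omega> (real CARD('n) / 2) (ennreal p) 1 (regular_distr \<Omega> g)"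

definition Bd2 :: "(real^'n) region \<Rightarrow> real \<Rightarrow> (real^'n \<Rightarrow> real) set" where
  "Bd2 \<Omega> p =
     {g \<in> L2_space \<Omega>. regular_distr \<Omega> g \<in> besov \<Omega> (real CARD('n) / 2) (ennreal p) 1}"

section \<open>Noise\<close>

text \<open>
  On the torus, \<open>B\<^sup>-\<^sup>d\<^sup>/\<^sup>2\<^bsub>p',\<infinity>\<^esub>\<close> is the member of the scale \<open>besov\<close>, and it is paired with
  \<open>B\<^sup>d\<^sup>/\<^sup>2\<^sub>p\<^sub>,\<^sub>1\<close> by summing the pairings of neighbouring dyadic blocks, all others being orthogonal.
  On a bounded Lipschitz domain, elements of \<open>B\<^sup>d\<^sup>/\<^sup>2\<^sub>p\<^sub>,\<^sub>1(\<Omega>)\<close> need not vanish at the boundary, test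
  functions are not dense, and the restriction space of negative order has no canonical pairing with
  \<open>B\<^sup>d\<^sup>/\<^sup>2\<^sub>p\<^sub>,\<^sub>1(\<Omega>)\<close>; there \<open>B\<^sup>-\<^sup>d\<^sup>/\<^sup>2\<^bsub>p',\<infinity>\<^esub>\<close> denotes, as usual in connection with a duality pairing,
  the dual space of \<open>B\<^sup>d\<^sup>/\<^sup>2\<^sub>p\<^sub>,\<^sub>1(\<Omega>)\<close>. Its elements are functionals on \<open>Bd2\<close>, whose
  restrictions to the test functions are distributions.
\<close>

fun noise_norm :: "(real^'n) region \<Rightarrow> real \<Rightarrow> 'n distr \<Rightarrow> ennreal" where
  "noise_norm Torus p Z =
     besov_norm Torus (- (real CARD('n) / 2)) (ennreal (p / (p - 1))) \<infinity> Z"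
| "noise_norm (Domain U) p Z = dual_norm (Bd2 (Domain U) p) (Bd2_norm (Domain U) p) Z"

fun noise_space :: "(real^'n) region \<Rightarrow> real \<Rightarrow> 'n distr set" where
  "noise_space Torus p = besov Torus (- (real CARD('n) / 2)) (ennreal (p / (p - 1))) \<infinity>"
| "noise_space (Domain U) p = dual_space (Bd2 (Domain U) p) (Bd2_norm (Domain U) p)"

fun noise_pairing :: "(real^'n) region \<Rightarrow> 'n distr \<Rightarrow> (real^'n \<Rightarrow> real) \<Rightarrow> real" where
  "noise_pairing Torus Z g =
     (\<Sum>j. \<Sum>i \<in> {i. i \<le> j + 1 \<and> j \<le> i + 1}.
        L2_inner Torus (block_torus i Z) (block_torus j (regular_distr Torus g)))"
| "noise_pairing (Domain U) Z g = Z g"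

text \<open>
  A random variable with values in \<open>\<D>'(\<Omega>)\<close>, measurable with respect to the \<open>\<sigma>\<close>-algebra generated by
  the evaluations at test functions.
\<close>

definition random_distribution ::
  "(real^'n) region \<Rightarrow> 'w measure \<Rightarrow> ('w \<Rightarrow> 'n distr) \<Rightarrow> bool" where
  "random_distribution \<Omega> M Z \<longleftrightarrow>
     prob_space M \<and>
     (\<forall>\<omega>\<in>space M. restrict_tests \<Omega> (Z \<omega>) \<in> distributions \<Omega>) \<and>
     (\<forall>\<phi>\<in>test_functions \<Omega>. (\<lambda>\<omega>. Z \<omega> \<phi>) \<in> borel_measurable M)"

section \<open>Convex analysis\<close>

definition convex_subset :: "('b \<Rightarrow> real) set \<Rightarrow> bool" where
  "convex_subset D \<longleftrightarrow>
     (\<forall>f\<in>D. \<forall>g\<in>D. \<forall>t\<in>{0..1}. (\<lambda>x. t * f x + (1 - t) * g x) \<in> D)"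

definition closed_subset ::
  "('b \<Rightarrow> real) set \<Rightarrow> (('b \<Rightarrow> real) \<Rightarrow> ennreal) \<Rightarrow> ('b \<Rightarrow> real) set \<Rightarrow> bool" where
  "closed_subset V nrm D \<longleftrightarrow>
     D \<subseteq> V \<and> (\<forall>u. \<forall>f\<in>V. (\<forall>n. u n \<in> D) \<and> (\<lambda>n. nrm (u n - f)) \<longlonglongrightarrow> 0 \<longrightarrow> f \<in> D)"

definition convex_functional :: "('b \<Rightarrow> real) set \<Rightarrow> (('b \<Rightarrow> real) \<Rightarrow> ereal) \<Rightarrow> bool" where
  "convex_functional V R \<longleftrightarrow>
     (\<forall>f\<in>V. R f \<noteq> -\<infinity>) \<and>
     (\<forall>f\<in>V. \<forall>g\<in>V. \<forall>t\<in>{0..1}.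
        R (\<lambda>x. t * f x + (1 - t) * g x) \<le> ereal t * R f + ereal (1 - t) * R g)"

text \<open>
  Gateaux differentiability at every point of the effective domain. Subtraction on functions is
  pointwise.
\<close>

definition differentiable_functional ::
  "('b \<Rightarrow> real) set \<Rightarrow> (('b \<Rightarrow> real) \<Rightarrow> ennreal) \<Rightarrow> (('b \<Rightarrow> real) \<Rightarrow> ereal) \<Rightarrow> bool" where
  "differentiable_functional V nrm R \<longleftrightarrow>
     (\<forall>h\<in>V. R h < \<infinity> \<longrightarrow>
        (\<exists>\<xi>\<in>dual_space V nrm. \<forall>v\<in>V.
           ((\<lambda>t. (R (\<lambda>x. h x + t * v x) - R h) / ereal t) \<longlongrightarrow> ereal (\<xi> v)) (at 0)))"

definition subdifferential ::
  "('b \<Rightarrow> real) set \<Rightarrow> (('b \<Rightarrow> real) \<Rightarrow> ennreal) \<Rightarrow> (('b \<Rightarrow> real) \<Rightarrow> ereal) \<Rightarrow>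
     ('b \<Rightarrow> real) \<Rightarrow> (('b \<Rightarrow> real) \<Rightarrow> real) set" where
  "subdifferential V nrm R h =
     {\<xi> \<in> dual_space V nrm. h \<in> V \<and> \<bar>R h\<bar> \<noteq> \<infinity> \<and> (\<forall>f\<in>V. R h + ereal (\<xi> (f - h)) \<le> R f)}"

text \<open>The second argument \<open>hs\<close> is the subgradient of \<open>R\<close> at \<open>h\<close> used in \<open>\<Delta>\<^sub>R(f,h)\<close>.\<close>

definition bregman ::
  "(('b \<Rightarrow> real) \<Rightarrow> ereal) \<Rightarrow> (('b \<Rightarrow> real) \<Rightarrow> real) \<Rightarrow> ('b \<Rightarrow> real) \<Rightarrow> ('b \<Rightarrow> real) \<Rightarrow> ereal" where
  "bregman R hs f h = R f - R h - ereal (hs (f - h))"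

definition concave_index_function :: "(real \<Rightarrow> real) \<Rightarrow> bool" where
  "concave_index_function \<psi> \<longleftrightarrow>
     (\<forall>u\<ge>0. \<psi> u \<ge> 0) \<and> concave_on {0..} \<psi> \<and> continuous_on {0..} \<psi> \<and> mono_on {0..} \<psi> \<and> \<psi> 0 = 0"

definition phi_index :: "(real \<Rightarrow> real) \<Rightarrow> real \<Rightarrow> ereal" where
  "phi_index \<psi> \<tau> = (SUP u\<in>{0..}. ereal (\<psi> u - u / \<tau>))"

section \<open>Tikhonov regularization\<close>

text \<open>The data \<open>g\<^sup>\<dagger> + \<epsilon>Z\<close> enter only through their pairing with \<open>B\<^sup>d\<^sup>/\<^sup>2\<^sub>p\<^sub>,\<^sub>1\<close>.\<close>

definition observed_data ::
  "(real^'n) region \<Rightarrow> (real^'n \<Rightarrow> real) \<Rightarrow> real \<Rightarrow> 'n distr \<Rightarrow> (real^'n \<Rightarrow> real) \<Rightarrow> real" where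
  "observed_data \<Omega> gdag \<epsilon> Z g = L2_inner \<Omega> gdag g + \<epsilon> * noise_pairing \<Omega> Z g"

definition tikhonov ::
  "(real^'n) region \<Rightarrow> ('n distr \<Rightarrow> real^'n \<Rightarrow> real) \<Rightarrow> ('n distr \<Rightarrow> ereal) \<Rightarrow> real \<Rightarrow>
     ((real^'n \<Rightarrow> real) \<Rightarrow> real) \<Rightarrow> 'n distr \<Rightarrow> ereal" where
  "tikhonov \<Omega> F R \<alpha> gobs f =
     ereal (1/2 * (L2_nrm \<Omega> (F f))\<^sup>2 - gobs (F f)) + ereal \<alpha> * R f"

definition err ::
  "(real^'n) region \<Rightarrow> (real^'n \<Rightarrow> real) \<Rightarrow> real \<Rightarrow> 'n distr \<Rightarrow> (real^'n \<Rightarrow> real) \<Rightarrow> real" where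
  "err \<Omega> gdag \<epsilon> Z g = \<epsilon> * noise_pairing \<Omega> Z (g - gdag)"

end

theory Submission
  imports Defs
begin

text \<open>
  Comparing the Tikhonov functional at the minimizer and at \<open>f\<^sup>\<dagger>\<close>, and inserting the source
  condition with \<open>\<psi>(a\<^sup>2) \<le> \<phi>\<^sub>\<psi>(4\<alpha>) + a\<^sup>2/(4\<alpha>)\<close>, gives \<open>a\<^sup>2/4 + \<alpha>\<Delta>/2 \<le> err + \<alpha>\<phi>\<^sub>\<psi>(4\<alpha>)\<close>, where \<open>a\<close> is
  the distance of \<open>F(f)\<close> to \<open>g\<^sup>\<dagger>\<close> in \<open>L\<^sup>2\<close>. By duality and interpolation, \<open>err \<le> M a\<^sup>\<beta>\<close> with \<open>M\<close>
  proportional to \<open>\<parallel>\<epsilon>Z\<parallel> \<Delta>\<^sup>\<gamma>\<close>. If \<open>err > \<alpha>\<phi>\<^sub>\<psi>(4\<alpha>)\<close>, then \<open>a\<^sup>2 \<le> 8 err\<close>, and both bounds follow by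
  solving \<open>err \<le> M (8 err)\<^bsup>\<beta>/2\<^esup>\<close> for \<open>err\<close> and then \<open>\<alpha>\<Delta>/2 \<le> 2 err\<close> for \<open>\<Delta>\<close>. On the torus the duality
  estimate amounts to Hoelder's inequality for neighbouring dyadic blocks.
\<close>

section \<open>Lebesgue norms\<close>

lemma epowr_ennreal: "0 \<le> x \<Longrightarrow> epowr (ennreal x) r = ennreal (x powr r)"
  by (simp add: epowr_def)

lemma epowr_one: "epowr a 1 = a"
  by (cases a) (auto simp: epowr_def)

text \<open>Since \<open>lp_norm\<close> is infinite by definition off the measurable functions and
  \<open>epowr\<close> preserves infinity, finiteness yields measurability and integrability at once
  and turns the extended norm into a Bochner integral.\<close>

lemma lp_norm_finite:
  assumes p: "0 < p" and fin: "lp_norm M (ennreal p) f < \<infinity>"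
  shows "f \<in> borel_measurable M"
    and "integrable M (\<lambda>x. \<bar>f x\<bar> powr p)"
    and "lp_norm M (ennreal p) f = ennreal ((\<integral>x. \<bar>f x\<bar> powr p \<partial>M) powr (1 / p))"
proof -
  show meas: "f \<in> borel_measurable M"
    using fin by (auto simp: lp_norm_def split: if_splits)
  have eq: "lp_norm M (ennreal p) f = epowr (\<integral>\<^sup>+x. ennreal (\<bar>f x\<bar> powr p) \<partial>M) (1 / p)"
    using p meas by (simp add: lp_norm_def elp_norm_def epowr_ennreal)
  have "(\<integral>\<^sup>+x. ennreal (\<bar>f x\<bar> powr p) \<partial>M) < \<infinity>"
    using fin unfolding eq by (auto simp: epowr_def less_top split: if_splits)
  then show int: "integrable M (\<lambda>x. \<bar>f x\<bar> powr p)"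
    using meas by (intro integrableI_nonneg) auto
  show "lp_norm M (ennreal p) f = ennreal ((\<integral>x. \<bar>f x\<bar> powr p \<partial>M) powr (1 / p))"
    unfolding eq using nn_integral_eq_integral[OF int] by (simp add: epowr_ennreal)
qed

text \<open>In the infinite case, which includes non-measurable \<open>f\<close>, the positive
  factor keeps the right-hand side infinite.\<close>

lemma lp_norm_cmult_le:
  assumes p: "0 < p" and c: "0 < c"
  shows "lp_norm M (ennreal p) (\<lambda>x. c * f x) \<le> ennreal c * lp_norm M (ennreal p) f"
proof (cases "lp_norm M (ennreal p) f < \<infinity>")
  case True
  note f = lp_norm_finite[OF p True]
  have "lp_norm M (ennreal p) (\<lambda>x. c * f x) =
      epowr (\<integral>\<^sup>+x. ennreal (\<bar>c * f x\<bar> powr p) \<partial>M) (1 / p)"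
    using p f(1) by (simp add: lp_norm_def elp_norm_def epowr_ennreal)
  also have "(\<lambda>x. \<bar>c * f x\<bar> powr p) = (\<lambda>x. c powr p * \<bar>f x\<bar> powr p)"
    using c by (auto simp: abs_mult powr_mult)
  also have "(\<integral>\<^sup>+x. ennreal (c powr p * \<bar>f x\<bar> powr p) \<partial>M) = ennreal (c powr p * (\<integral>x. \<bar>f x\<bar> powr p \<partial>M))"
    using f(2) by (subst nn_integral_eq_integral) auto
  also have "epowr \<dots> (1 / p) = ennreal c * lp_norm M (ennreal p) f"
    unfolding f(3) using c p
    by (simp add: epowr_ennreal powr_mult powr_powr integral_nonneg_AE flip: ennreal_mult)
  finally show ?thesis by simp
next
  case False
  then have "lp_norm M (ennreal p) f = top" by (simp add: less_top[symmetric])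
  then show ?thesis using c by (simp add: ennreal_mult_top)
qed

text \<open>Young's inequality bounds the product by an integrable function. Applied again after
  dividing \<open>f\<close> and \<open>g\<close> by their norms, it integrates to
  \<open>1 / p + 1 / q = 1\<close>, which gives the constant 1.\<close>

lemma Hoelder_lp_norm:
  fixes f g :: "'b \<Rightarrow> real"
  assumes p: "1 < p" and q: "1 < q" and pq: "1 / p + 1 / q = 1"
    and f: "lp_norm M (ennreal p) f < \<infinity>" and g: "lp_norm M (ennreal q) g < \<infinity>"
  shows "integrable M (\<lambda>x. f x * g x)"
    and "\<bar>\<integral>x. f x * g x \<partial>M\<bar> \<le> enn2real (lp_norm M (ennreal p) f) * enn2real (lp_norm M (ennreal q) g)"
proof -
  have p0: "0 < p" and q0: "0 < q" using p q by auto
  note f = lp_norm_finite[OF p0 f] and g = lp_norm_finite[OF q0 g]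
  define A where "A = (\<integral>x. \<bar>f x\<bar> powr p \<partial>M)"
  define B where "B = (\<integral>x. \<bar>g x\<bar> powr q \<partial>M)"
  have A0: "0 \<le> A" and B0: "0 \<le> B" unfolding A_def B_def by (auto intro: integral_nonneg_AE)
  have dom: "integrable M (\<lambda>x. \<bar>f x\<bar> powr p / p + \<bar>g x\<bar> powr q / q)"
    using f(2) g(2) by auto
  have fg: "f \<in> borel_measurable M" "g \<in> borel_measurable M" by fact+
  show int: "integrable M (\<lambda>x. f x * g x)"
  proof (rule Bochner_Integration.integrable_bound[OF dom])
    show "(\<lambda>x. f x * g x) \<in> borel_measurable M" using fg by measurable
    have "norm (f x * g x) \<le> norm (\<bar>f x\<bar> powr p / p + \<bar>g x\<bar> powr q / q)" for x
      using Youngs_inequality[OF p q pq, of "\<bar>f x\<bar>" "\<bar>g x\<bar>"] by (simp add: abs_mult)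
    then show "AE x in M. norm (f x * g x) \<le> norm (\<bar>f x\<bar> powr p / p + \<bar>g x\<bar> powr q / q)" by simp
  qed
  \<comment> \<open>The normalization divides by both norms, so the case of a vanishing norm, where
    the product is zero almost everywhere, comes first.\<close>
  have "\<bar>\<integral>x. f x * g x \<partial>M\<bar> \<le> A powr (1 / p) * B powr (1 / q)"
  proof (cases "A = 0 \<or> B = 0")
    case True
    then have "AE x in M. f x * g x = 0"
    proof
      assume "A = 0"
      then have "AE x in M. \<bar>f x\<bar> powr p = 0"
        using integral_nonneg_eq_0_iff_AE[OF f(2)] by (simp add: A_def)
      then show ?thesis by eventually_elim auto
    next
      assume "B = 0"
      then have "AE x in M. \<bar>g x\<bar> powr q = 0"
        using integral_nonneg_eq_0_iff_AE[OF g(2)] by (simp add: B_def)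
      then show ?thesis by eventually_elim auto
    qed
    then have "(\<integral>x. f x * g x \<partial>M) = 0" by (rule integral_eq_zero_AE)
    then show ?thesis by simp
  next
    case False
    then have A: "0 < A" and B: "0 < B" using A0 B0 by auto
    define a b where "a = A powr (1 / p)" and "b = B powr (1 / q)"
    have ab: "0 < a" "0 < b" "a powr p = A" "b powr q = B"
      using A B p0 q0 by (auto simp: a_def b_def powr_powr)
    have ptw: "\<bar>f x * g x\<bar> \<le> a * b * (\<bar>f x\<bar> powr p / (A * p) + \<bar>g x\<bar> powr q / (B * q))" for x
    proof -
      have "\<bar>f x\<bar> / a * (\<bar>g x\<bar> / b) \<le> (\<bar>f x\<bar> / a) powr p / p + (\<bar>g x\<bar> / b) powr q / q"
        using ab by (intro Youngs_inequality[OF p q pq]) auto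
      also have "\<dots> = \<bar>f x\<bar> powr p / (A * p) + \<bar>g x\<bar> powr q / (B * q)"
        using ab by (simp add: powr_divide)
      finally show ?thesis using ab by (simp add: abs_mult field_simps)
    qed
    have "\<bar>\<integral>x. f x * g x \<partial>M\<bar> \<le> (\<integral>x. \<bar>f x * g x\<bar> \<partial>M)"
      by (rule integral_abs_bound)
    also have "\<dots> \<le> (\<integral>x. a * b * (\<bar>f x\<bar> powr p / (A * p) + \<bar>g x\<bar> powr q / (B * q)) \<partial>M)"
      using int f(2) g(2) ptw by (intro integral_mono) auto
    also have "\<dots> = a * b * (A / (A * p) + B / (B * q))"
      using f(2) g(2) by (simp add: A_def B_def)
    also have "\<dots> = a * b" using A B pq by simp
    finally show ?thesis by (simp add: a_def b_def)
  qed
  then show "\<bar>\<integral>x. f x * g x \<partial>M\<bar> \<le> enn2real (lp_norm M (ennreal p) f) * enn2real (lp_norm M (ennreal q) g)"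
    unfolding f(3) g(3) A_def B_def by simp
qed

section \<open>Besov sequence norms\<close>

lemma besov_sequence_norm_one:
  "besov_sequence_norm M s p 1 b = (\<Sum>j. ennreal (2 powr (real j * s)) * lp_norm M p (b j))"
  by (simp add: besov_sequence_norm_def elp_norm_def epowr_one nn_integral_count_space_nat)

text \<open>Null sets of the counting measure are empty, so the essential supremum in
  \<open>elp_norm\<close> is a plain supremum; this lemma and the next are its two halves.\<close>

lemma besov_sequence_norm_infinity:
  "ennreal (2 powr (real j * s)) * lp_norm M p (b j) \<le> besov_sequence_norm M s p \<infinity> b"
  unfolding besov_sequence_norm_def elp_norm_def by (auto simp: AE_count_space intro!: Inf_greatest)

lemma besov_sequence_norm_infinity_least:
  assumes "\<And>j. ennreal (2 powr (real j * s)) * lp_norm M p (b j) \<le> K"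
  shows "besov_sequence_norm M s p \<infinity> b \<le> K"
  unfolding besov_sequence_norm_def elp_norm_def using assms by (auto simp: AE_count_space intro!: Inf_lower)

lemma card_neighbours: "card {i::nat. i \<le> j + 1 \<and> j \<le> i + 1} \<le> 3"
proof -
  \<comment> \<open>Subtraction is truncated: for \<open>j = 0\<close> the interval is
    \<open>{0..1}\<close>, still within the bound 3.\<close>
  have "{i::nat. i \<le> j + 1 \<and> j \<le> i + 1} \<subseteq> {j - 1..j + 1}" by auto
  then have "card {i::nat. i \<le> j + 1 \<and> j \<le> i + 1} \<le> card {j - 1..j + 1}" by (intro card_mono) auto
  then show ?thesis by simp
qed

text \<open>Hoelder's inequality handles each pair of blocks. The weights of \<open>b\<close> and
  \<open>c\<close> cancel up to the factor \<open>2 powr s\<close>, at most three \<open>i\<close>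
  belong to each \<open>j\<close>, and what remains is the series defining the norm of
  \<open>c\<close>.\<close>

lemma besov_sequence_duality:
  fixes b c :: "nat \<Rightarrow> real^'n \<Rightarrow> real"
  assumes p: "1 < p" and s: "0 \<le> s"
    and b: "besov_sequence_norm M (- s) (ennreal (p / (p - 1))) \<infinity> b < \<infinity>" (is "?B < \<infinity>")
    and c: "besov_sequence_norm M s (ennreal p) 1 c < \<infinity>" (is "?C < \<infinity>")
  defines "t \<equiv> \<lambda>j. \<Sum>i\<in>{i. i \<le> j + 1 \<and> j \<le> i + 1}. \<integral>x. b i x * c j x \<partial>M"
  shows "integrable M (\<lambda>x. b i x * c j x)"
    and "summable t"
    and "\<bar>suminf t\<bar> \<le> 3 * 2 powr s * enn2real ?B * enn2real ?C"
proof -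
  define q where "q = p / (p - 1)"
  have q: "1 < q" "1 / q + 1 / p = 1" using p by (auto simp: q_def field_simps)
  have b_le: "ennreal (2 powr (real j * (- s))) * lp_norm M (ennreal q) (b j) \<le> ?B" for j
    unfolding q_def by (rule besov_sequence_norm_infinity)
  have bfin: "lp_norm M (ennreal q) (b j) < \<infinity>" for j
    using b_le[of j] b by (auto simp: less_top[symmetric] ennreal_mult_eq_top_iff top_unique)
  define x where "x j = 2 powr (real j * s) * enn2real (lp_norm M (ennreal p) (c j))" for j
  have cfin: "lp_norm M (ennreal p) (c j) < \<infinity>" for j
  proof -
    have "ennreal (2 powr (real j * s)) * lp_norm M (ennreal p) (c j) \<noteq> \<infinity>"
      using ennreal_suminf_lessD[OF c[unfolded besov_sequence_norm_one], of j] by simp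
    then show ?thesis by (auto simp: less_top ennreal_mult_eq_top_iff)
  qed
  have x0: "0 \<le> x j" for j by (simp add: x_def)
  have Csum: "?C = (\<Sum>j. ennreal (x j))"
    unfolding besov_sequence_norm_one x_def using cfin by (simp add: ennreal_mult less_top)
  have xs: "summable x"
    using c unfolding Csum by (intro summable_suminf_not_top x0) auto
  have xC: "suminf x = enn2real ?C"
    unfolding Csum using suminf_ennreal2[OF x0 xs] suminf_nonneg[OF xs x0] by simp
  define N where "N = enn2real ?B"
  have b_le': "enn2real (lp_norm M (ennreal q) (b i)) \<le> 2 powr (real i * s) * N" for i
  proof -
    have "2 powr (real i * (- s)) * enn2real (lp_norm M (ennreal q) (b i)) \<le> N"
      using enn2real_mono[OF b_le[of i]] b by (simp add: N_def enn2real_mult)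
    then show ?thesis by (simp add: powr_minus field_simps)
  qed
  note H = Hoelder_lp_norm[OF q(1) p q(2) bfin cfin]
  show "integrable M (\<lambda>x. b i x * c j x)" by (rule H)
  \<comment> \<open>The factor \<open>2 powr s\<close> is the cost of the upper neighbour
    \<open>i = j + 1\<close>; smaller \<open>i\<close> are covered because
    \<open>0 \<le> s\<close>.\<close>
  have term_le: "\<bar>\<integral>x. b i x * c j x \<partial>M\<bar> \<le> 2 powr s * N * x j" if "i \<le> j + 1" for i j
  proof -
    have "\<bar>\<integral>x. b i x * c j x \<partial>M\<bar> \<le> (2 powr (real i * s) * N) * enn2real (lp_norm M (ennreal p) (c j))"
      by (rule order_trans[OF H(2)]) (intro mult_right_mono b_le' enn2real_nonneg)
    also have "\<dots> \<le> (2 powr (s + real j * s) * N) * enn2real (lp_norm M (ennreal p) (c j))"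
    proof -
      have "real i * s \<le> real (j + 1) * s" using that s by (intro mult_right_mono) auto
      then have "real i * s \<le> s + real j * s" by (simp add: algebra_simps)
      then show ?thesis by (intro mult_right_mono powr_mono) (auto simp: N_def)
    qed
    finally show ?thesis by (simp add: x_def powr_add mult_ac)
  qed
  have t_le: "\<bar>t j\<bar> \<le> 3 * 2 powr s * N * x j" for j
  proof -
    have "\<bar>t j\<bar> \<le> (\<Sum>i\<in>{i. i \<le> j + 1 \<and> j \<le> i + 1}. 2 powr s * N * x j)"
      unfolding t_def by (intro sum_abs[THEN order_trans] sum_mono term_le) auto
    also have "\<dots> = real (card {i. i \<le> j + 1 \<and> j \<le> i + 1}) * (2 powr s * N * x j)" by simp
    also have "\<dots> \<le> 3 * (2 powr s * N * x j)"
      using card_neighbours[of j] x0[of j] by (intro mult_right_mono) (auto simp: N_def)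
    finally show ?thesis by (simp add: mult_ac)
  qed
  have ds: "summable (\<lambda>j. 3 * 2 powr s * N * x j)" using xs by (rule summable_mult)
  have abs_t: "summable (\<lambda>j. \<bar>t j\<bar>)"
    by (rule summable_comparison_test'[OF ds]) (use t_le in auto)
  then show "summable t" by (rule summable_rabs_cancel)
  have "\<bar>suminf t\<bar> \<le> (\<Sum>j. \<bar>t j\<bar>)" by (rule summable_rabs[OF abs_t])
  also have "\<dots> \<le> (\<Sum>j. 3 * 2 powr s * N * x j)" by (rule suminf_le[OF t_le abs_t ds])
  also have "\<dots> = 3 * 2 powr s * N * suminf x" using xs by (rule suminf_mult)
  finally show "\<bar>suminf t\<bar> \<le> 3 * 2 powr s * enn2real ?B * enn2real ?C" by (simp add: xC N_def)
qed

section \<open>Test functions and square integrable functions\<close>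

lemma test_function_continuous:
  assumes "\<phi> \<in> test_functions \<Omega>"
  shows "continuous_on S \<phi>"
proof -
  have "smooth \<phi>" using assms by (cases \<Omega>) auto
  \<comment> \<open>The empty list of directions in \<open>smooth\<close> gives differentiability of
    \<open>\<phi>\<close> itself.\<close>
  then have "iter_deriv [] \<phi> differentiable_on UNIV" unfolding smooth_def by blast
  then have "continuous_on UNIV \<phi>" by (auto dest: differentiable_imp_continuous_on)
  then show ?thesis by (rule continuous_on_subset) simp
qed

text \<open>Lets torus and domain be treated alike: only a bounded set of finite measure matters
  below.\<close>

lemma region_measure_lebesgue_on:
  assumes "admissible \<Omega>"
  obtains S where "region_measure \<Omega> = lebesgue_on S" "S \<in> lmeasurable" "bounded S"
proof (cases \<Omega>)
  case Torus
  then show ?thesis using that[of "cbox 0 One"] by (auto simp: bounded_cbox)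
next
  case (Domain U)
  then show ?thesis using assms that[of U]
    by (auto simp: bounded_Lipschitz_domain_def intro: lmeasurable_open)
qed

text \<open>A test function is continuous, hence bounded by some \<open>B\<close> on the compact
  closure of the region, and \<open>(g x)\<^sup>2 + B\<^sup>2\<close> is an integrable majorant
  because the measure is finite. This makes \<open>regular_distr\<close> additive in
  \<open>g\<close>.\<close>

lemma integrable_L2_mult_test:
  assumes adm: "admissible \<Omega>" and g: "g \<in> L2_space \<Omega>" and phi: "\<phi> \<in> test_functions \<Omega>"
  shows "integrable (region_measure \<Omega>) (\<lambda>x. g x * \<phi> x)"
proof -
  obtain S where S: "region_measure \<Omega> = lebesgue_on S" "S \<in> lmeasurable" "bounded S"
    by (rule region_measure_lebesgue_on[OF adm])
  interpret finite_measure "region_measure \<Omega>"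
    unfolding S(1) by (rule finite_measure_lebesgue_on[OF S(2)])
  have "compact (\<phi> ` closure S)"
    using S(3) by (intro compact_continuous_image test_function_continuous[OF phi]) simp
  then obtain B where B: "\<And>x. x \<in> S \<Longrightarrow> \<bar>\<phi> x\<bar> \<le> B"
    using closure_subset[of S] by (fastforce dest: compact_imp_bounded simp: bounded_iff)
  have m: "g \<in> borel_measurable (region_measure \<Omega>)" and i: "integrable (region_measure \<Omega>) (\<lambda>x. (g x)\<^sup>2)"
    using g by (auto simp: L2_space_def)
  have mphi: "\<phi> \<in> borel_measurable (region_measure \<Omega>)"
    unfolding S(1) using S(2)
    by (intro continuous_imp_measurable_on_sets_lebesgue test_function_continuous[OF phi]) auto
  have dom: "integrable (region_measure \<Omega>) (\<lambda>x. (g x)\<^sup>2 + B\<^sup>2)" using i by auto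
  show ?thesis
  proof (rule Bochner_Integration.integrable_bound[OF dom])
    show "(\<lambda>x. g x * \<phi> x) \<in> borel_measurable (region_measure \<Omega>)" using m mphi by measurable
    have "norm (g x * \<phi> x) \<le> norm ((g x)\<^sup>2 + B\<^sup>2)" if "x \<in> S" for x
    proof -
      have "2 * (\<bar>g x\<bar> * B) \<le> (g x)\<^sup>2 + B\<^sup>2"
        using sum_squares_bound[of "\<bar>g x\<bar>" B] by (simp add: mult_ac)
      moreover have "\<bar>g x\<bar> * \<bar>\<phi> x\<bar> \<le> \<bar>g x\<bar> * B" using B[OF that] by (intro mult_left_mono) auto
      moreover have "0 \<le> \<bar>g x\<bar> * \<bar>\<phi> x\<bar>" by simp
      ultimately show ?thesis unfolding real_norm_def abs_mult by linarith
    qed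
    then show "AE x in region_measure \<Omega>. norm (g x * \<phi> x) \<le> norm ((g x)\<^sup>2 + B\<^sup>2)"
      unfolding S(1) by (intro AE_I2) auto
  qed
qed

lemma regular_distr_diff:
  assumes "admissible \<Omega>" "g \<in> L2_space \<Omega>" "h \<in> L2_space \<Omega>"
  shows "regular_distr \<Omega> (g - h) = (\<lambda>\<phi>. regular_distr \<Omega> g \<phi> - regular_distr \<Omega> h \<phi>)"
  using integrable_L2_mult_test[OF assms(1)] assms(2,3)
  by (auto simp: regular_distr_def restrict_tests_def fun_eq_iff left_diff_distrib)

section \<open>Inner product structure of \<open>L2_space\<close>\<close>

lemma L2_integrable_mult:
  assumes "g \<in> L2_space \<Omega>" "h \<in> L2_space \<Omega>"
  shows "integrable (region_measure \<Omega>) (\<lambda>x. g x * h x)"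
proof -
  have gh: "g \<in> borel_measurable (region_measure \<Omega>)" "h \<in> borel_measurable (region_measure \<Omega>)"
    and dom: "integrable (region_measure \<Omega>) (\<lambda>x. (g x)\<^sup>2 + (h x)\<^sup>2)"
    using assms by (auto simp: L2_space_def)
  show ?thesis
  proof (rule Bochner_Integration.integrable_bound[OF dom])
    show "(\<lambda>x. g x * h x) \<in> borel_measurable (region_measure \<Omega>)" using gh by measurable
    have "norm (g x * h x) \<le> norm ((g x)\<^sup>2 + (h x)\<^sup>2)" for x
    proof -
      have "2 * (\<bar>g x\<bar> * \<bar>h x\<bar>) \<le> (g x)\<^sup>2 + (h x)\<^sup>2"
        using sum_squares_bound[of "\<bar>g x\<bar>" "\<bar>h x\<bar>"] by (simp add: mult.assoc)
      moreover have "0 \<le> \<bar>g x\<bar> * \<bar>h x\<bar>" by simp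
      ultimately show ?thesis unfolding real_norm_def abs_mult by linarith
    qed
    then show "AE x in region_measure \<Omega>. norm (g x * h x) \<le> norm ((g x)\<^sup>2 + (h x)\<^sup>2)" by simp
  qed
qed

lemma L2_space_diff:
  assumes "g \<in> L2_space \<Omega>" "h \<in> L2_space \<Omega>"
  shows "g - h \<in> L2_space \<Omega>"
  using assms L2_integrable_mult[OF assms]
  by (auto simp: L2_space_def fun_diff_def power2_diff mult.assoc)

lemma L2_nrm_nonneg: "0 \<le> L2_nrm \<Omega> g"
  by (simp add: L2_nrm_def L2_inner_def integral_nonneg_AE)

lemma L2_nrm_power2: "(L2_nrm \<Omega> g)\<^sup>2 = L2_inner \<Omega> g g"
  by (simp add: L2_nrm_def L2_inner_def integral_nonneg_AE)

lemma L2_nrm_minus_commute: "L2_nrm \<Omega> (g - h) = L2_nrm \<Omega> (h - g)"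
  by (simp add: L2_nrm_def L2_inner_def algebra_simps)

text \<open>Completes the square in the Tikhonov functional; the argument order in
  \<open>L2_inner \<Omega> h g\<close> is that of \<open>observed_data\<close>, with
  \<open>h\<close> as the exact data.\<close>

lemma L2_nrm_diff_power2:
  assumes "g \<in> L2_space \<Omega>" "h \<in> L2_space \<Omega>"
  shows "(L2_nrm \<Omega> (g - h))\<^sup>2 = (L2_nrm \<Omega> g)\<^sup>2 - 2 * L2_inner \<Omega> h g + (L2_nrm \<Omega> h)\<^sup>2"
proof -
  note i = L2_integrable_mult[OF assms(1,1)] L2_integrable_mult[OF assms(2,2)]
    L2_integrable_mult[OF assms(2,1)]
  have "L2_inner \<Omega> (g - h) (g - h) =
      (\<integral>x. (g x * g x - 2 * (h x * g x)) + h x * h x \<partial>region_measure \<Omega>)"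
    unfolding L2_inner_def by (intro Bochner_Integration.integral_cong) (auto simp: algebra_simps)
  also have "\<dots> = L2_inner \<Omega> g g - 2 * L2_inner \<Omega> h g + L2_inner \<Omega> h h"
    using i by (simp add: L2_inner_def)
  finally show ?thesis by (simp add: L2_nrm_power2)
qed

section \<open>The duality pairing with the noise\<close>

text \<open>Every admissible constant is at least the quotient by \<open>nrm v\<close>, hence so is
  the infimum. If \<open>nrm v\<close> is zero there is no quotient, but finiteness provides an
  admissible constant, which forces \<open>\<xi> v\<close> to vanish.\<close>

lemma dual_norm_bound:
  assumes fin: "dual_norm V nrm \<xi> < \<infinity>" and v: "v \<in> V" "nrm v < \<infinity>"
  shows "ennreal \<bar>\<xi> v\<bar> \<le> dual_norm V nrm \<xi> * nrm v"
proof (cases "nrm v = 0")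
  case True
  obtain K where "\<forall>v\<in>V. ennreal \<bar>\<xi> v\<bar> \<le> K * nrm v"
    using fin unfolding dual_norm_def by (auto simp: Inf_less_iff)
  then have "ennreal \<bar>\<xi> v\<bar> \<le> K * nrm v" using v(1) by blast
  then show ?thesis using True by simp
next
  case False
  have "ennreal \<bar>\<xi> v\<bar> / nrm v \<le> dual_norm V nrm \<xi>"
    unfolding dual_norm_def using v False
    by (intro Inf_greatest divide_le_posI_ennreal) (auto simp: mult.commute zero_less_iff_neq_zero)
  then have "ennreal \<bar>\<xi> v\<bar> / nrm v * nrm v \<le> dual_norm V nrm \<xi> * nrm v"
    by (rule mult_right_mono) simp
  then show ?thesis using v False by (simp add: ennreal_divide_times)
qed

lemma dual_norm_cmult_finite:
  assumes "dual_norm V nrm \<xi> < \<infinity>"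
  shows "dual_norm V nrm (\<lambda>v. c * \<xi> v) < \<infinity>"
proof -
  obtain K where K: "K < \<infinity>" "\<forall>v\<in>V. ennreal \<bar>\<xi> v\<bar> \<le> K * nrm v"
    using assms unfolding dual_norm_def by (auto simp: Inf_less_iff)
  have "ennreal \<bar>c * \<xi> v\<bar> \<le> ennreal \<bar>c\<bar> * K * nrm v" if "v \<in> V" for v
    using mult_left_mono[OF K(2)[rule_format, OF that], of "ennreal \<bar>c\<bar>"]
    by (simp add: abs_mult ennreal_mult mult.assoc)
  then have "dual_norm V nrm (\<lambda>v. c * \<xi> v) \<le> ennreal \<bar>c\<bar> * K"
    unfolding dual_norm_def by (intro Inf_lower) simp
  also have "\<dots> < \<infinity>" using K(1) by (simp add: ennreal_mult_less_top)
  finally show ?thesis .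
qed

section \<open>Linearity of the torus blocks and scaling of the noise\<close>

lemma block_torus_diff:
  "block_torus j (\<lambda>\<phi>. S \<phi> - T \<phi>) x = block_torus j S x - block_torus j T x"
  by (simp add: block_torus_def algebra_simps flip: sum_subtractf)

lemma block_torus_cmult: "block_torus j (\<lambda>\<phi>. c * T \<phi>) x = c * block_torus j T x"
  unfolding block_torus_def sum_distrib_left by (rule sum.cong) (auto simp: algebra_simps)

text \<open>The rates contain \<open>enn2real\<close> of the norm of the scaled noise, and
  \<open>enn2real\<close> sends infinity to 0; finiteness makes this number the true norm.\<close>

lemma noise_norm_cmult_finite:
  fixes Z :: "'n::finite distr"
  assumes p: "1 < p" and c: "0 < c" and Z: "Z \<in> noise_space \<Omega> p"
  shows "noise_norm \<Omega> p (\<lambda>\<phi>. c * Z \<phi>) < \<infinity>"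
proof (cases \<Omega>)
  case Torus
  let ?s = "- (real CARD('n) / 2)" and ?q = "ennreal (p / (p - 1))" and ?M = "region_measure (Torus :: (real^'n) region)"
  have fin: "besov_norm Torus ?s ?q \<infinity> Z < \<infinity>" using Z Torus by (simp add: besov_def)
  have "ennreal (2 powr (real j * ?s)) * lp_norm ?M ?q (block_torus j (\<lambda>\<phi>. c * Z \<phi>)) \<le>
      ennreal c * besov_norm Torus ?s ?q \<infinity> Z" for j
  proof -
    have "block_torus j (\<lambda>\<phi>. c * Z \<phi>) = (\<lambda>x. c * block_torus j Z x)"
      by (rule ext) (rule block_torus_cmult)
    then have "lp_norm ?M ?q (block_torus j (\<lambda>\<phi>. c * Z \<phi>)) \<le> ennreal c * lp_norm ?M ?q (block_torus j Z)"
      using p c lp_norm_cmult_le[of "p / (p - 1)" c ?M "block_torus j Z"] by simp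
    then have "ennreal (2 powr (real j * ?s)) * lp_norm ?M ?q (block_torus j (\<lambda>\<phi>. c * Z \<phi>)) \<le>
        ennreal c * (ennreal (2 powr (real j * ?s)) * lp_norm ?M ?q (block_torus j Z))"
      by (subst mult.left_commute) (rule mult_left_mono, auto)
    also have "\<dots> \<le> ennreal c * besov_norm Torus ?s ?q \<infinity> Z"
      unfolding besov_norm.simps by (intro mult_left_mono besov_sequence_norm_infinity) simp
    finally show ?thesis .
  qed
  then have "besov_norm Torus ?s ?q \<infinity> (\<lambda>\<phi>. c * Z \<phi>) \<le> ennreal c * besov_norm Torus ?s ?q \<infinity> Z"
    unfolding besov_norm.simps by (intro besov_sequence_norm_infinity_least)
  also have "\<dots> < \<infinity>" using fin by (simp add: ennreal_mult_less_top)
  finally show ?thesis using Torus by simp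
next
  case (Domain U)
  then have "dual_norm (Bd2 \<Omega> p) (Bd2_norm \<Omega> p) Z < \<infinity>" using Z by (simp add: dual_space_def)
  then show ?thesis unfolding Domain noise_norm.simps by (rule dual_norm_cmult_finite)
qed

text \<open>The case \<open>s = d / 2\<close> of \<open>besov_sequence_duality\<close>. Summability
  ensures that the \<open>suminf\<close> in \<open>noise_pairing\<close> is the sum of a convergent
  series.\<close>

lemma torus_pairing:
  fixes Z T :: "'n::finite distr"
  assumes p: "1 < p"
    and Z: "besov_norm Torus (- (real CARD('n) / 2)) (ennreal (p / (p - 1))) \<infinity> Z < \<infinity>"
    and T: "besov_norm Torus (real CARD('n) / 2) (ennreal p) 1 T < \<infinity>"
  defines "t \<equiv> \<lambda>j. \<Sum>i\<in>{i. i \<le> j + 1 \<and> j \<le> i + 1}. L2_inner Torus (block_torus i Z) (block_torus j T)"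
  shows "integrable (region_measure Torus) (\<lambda>x. block_torus i Z x * block_torus j T x)"
    and "summable t"
    and "\<bar>suminf t\<bar> \<le> 3 * 2 powr (real CARD('n) / 2) *
      enn2real (besov_norm Torus (- (real CARD('n) / 2)) (ennreal (p / (p - 1))) \<infinity> Z) *
      enn2real (besov_norm Torus (real CARD('n) / 2) (ennreal p) 1 T)"
  using besov_sequence_duality[OF p _ Z[unfolded besov_norm.simps] T[unfolded besov_norm.simps]]
  unfolding t_def L2_inner_def besov_norm.simps by simp_all

lemma Bd2_norm_finite: "g \<in> Bd2 \<Omega> p \<Longrightarrow> Bd2_norm \<Omega> p g < \<infinity>"
  by (simp add: Bd2_def Bd2_norm_def besov_def)

text \<open>The constant is the one from the torus; on a domain the definition of the dual norm
  gives constant 1, which is enlarged to the common value.\<close>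

lemma noise_pairing_bound:
  fixes Z :: "'n::finite distr"
  assumes p: "1 < p" and \<epsilon>: "0 < \<epsilon>" and Z: "Z \<in> noise_space \<Omega> p" and v: "v \<in> Bd2 \<Omega> p"
  shows "\<bar>\<epsilon> * noise_pairing \<Omega> Z v\<bar> \<le> 3 * 2 powr (real CARD('n) / 2) *
    enn2real (noise_norm \<Omega> p (\<lambda>\<phi>. \<epsilon> * Z \<phi>)) * enn2real (Bd2_norm \<Omega> p v)"
proof (cases \<Omega>)
  case Torus
  have T: "besov_norm Torus (real CARD('n) / 2) (ennreal p) 1 (regular_distr Torus v) < \<infinity>"
    using Bd2_norm_finite[OF v] Torus by (simp add: Bd2_norm_def)
  have Z1: "besov_norm Torus (- (real CARD('n) / 2)) (ennreal (p / (p - 1))) \<infinity> Z < \<infinity>"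
    using Z Torus by (simp add: besov_def)
  have Z2: "besov_norm Torus (- (real CARD('n) / 2)) (ennreal (p / (p - 1))) \<infinity> (\<lambda>\<phi>. \<epsilon> * Z \<phi>) < \<infinity>"
    using noise_norm_cmult_finite[OF p \<epsilon> Z] Torus by simp
  have "L2_inner Torus (block_torus i (\<lambda>\<phi>. \<epsilon> * Z \<phi>)) h = \<epsilon> * L2_inner Torus (block_torus i Z) h" for i h
    by (simp add: L2_inner_def block_torus_cmult mult.assoc)
  note cmult = this
  \<comment> \<open>Moving \<open>\<epsilon>\<close> through the convergent series into the blocks
    of \<open>Z\<close> makes the norm of the scaled noise appear.\<close>
  have "\<epsilon> * noise_pairing Torus Z v =
      (\<Sum>j. \<epsilon> * (\<Sum>i\<in>{i. i \<le> j + 1 \<and> j \<le> i + 1}.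
        L2_inner Torus (block_torus i Z) (block_torus j (regular_distr Torus v))))"
    unfolding noise_pairing.simps by (rule suminf_mult[OF torus_pairing(2)[OF p Z1 T], symmetric])
  also have "\<dots> = (\<Sum>j. \<Sum>i\<in>{i. i \<le> j + 1 \<and> j \<le> i + 1}.
        L2_inner Torus (block_torus i (\<lambda>\<phi>. \<epsilon> * Z \<phi>)) (block_torus j (regular_distr Torus v)))"
    unfolding sum_distrib_left cmult ..
  finally show ?thesis
    using torus_pairing(3)[OF p Z2 T] Torus by (simp add: Bd2_norm_def)
next
  case (Domain U)
  let ?W = "\<lambda>\<phi>. \<epsilon> * Z \<phi>"
  let ?N = "dual_norm (Bd2 \<Omega> p) (Bd2_norm \<Omega> p) ?W"
  have fin: "?N < \<infinity>" using noise_norm_cmult_finite[OF p \<epsilon> Z] Domain by simp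
  have "ennreal \<bar>?W v\<bar> \<le> ?N * Bd2_norm \<Omega> p v"
    by (rule dual_norm_bound[OF fin v Bd2_norm_finite[OF v]])
  then have "\<bar>?W v\<bar> \<le> enn2real ?N * enn2real (Bd2_norm \<Omega> p v)"
    using fin Bd2_norm_finite[OF v]
    by (cases "?N"; cases "Bd2_norm \<Omega> p v") (auto simp flip: ennreal_mult)
  also have "\<dots> \<le> (3 * 2 powr (real CARD('n) / 2)) * (enn2real ?N * enn2real (Bd2_norm \<Omega> p v))"
  proof -
    have "1 \<le> 3 * 2 powr (real CARD('n) / 2)" using ge_one_powr_ge_zero[of 2 "real CARD('n) / 2"] by simp
    then show ?thesis
      using mult_right_mono[of 1 _ "enn2real ?N * enn2real (Bd2_norm \<Omega> p v)"] by simp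
  qed
  finally show ?thesis using Domain by (simp add: mult.assoc)
qed

section \<open>Differences in \<open>Bd2\<close> and linearity of the pairing\<close>

lemma distributions_diff:
  assumes S: "S \<in> distributions \<Omega>" and T: "T \<in> distributions \<Omega>"
  shows "(\<lambda>\<phi>. S \<phi> - T \<phi>) \<in> distributions \<Omega>"
proof -
  let ?D = "\<lambda>\<phi>. S \<phi> - T \<phi>"
  have lin: "linear_functional_on (test_functions \<Omega>) ?D"
    using S T unfolding distributions_def linear_functional_on_def by (simp add: algebra_simps)
  have restr: "restrict_tests \<Omega> ?D = ?D"
  proof
    fix \<phi>
    have "restrict_tests \<Omega> S \<phi> = S \<phi>" "restrict_tests \<Omega> T \<phi> = T \<phi>"
      using S T by (auto simp: distributions_def)
    then show "restrict_tests \<Omega> ?D \<phi> = ?D \<phi>" by (auto simp: restrict_tests_def split: if_splits)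
  qed
  \<comment> \<open>In the seminorm estimates the constants add up, and a bound on derivatives up to
    order \<open>max N N'\<close> serves both distributions.\<close>
  have sum: "\<bar>S \<phi> - T \<phi>\<bar> \<le> (C + C') * B" if "\<bar>S \<phi>\<bar> \<le> C * B" "\<bar>T \<phi>\<bar> \<le> C' * B" for C C' B \<phi>
    using that by (simp add: distrib_right)
  have cont: "continuous_on_tests \<Omega> ?D"
  proof (cases \<Omega>)
    case Torus
    have cS: "continuous_on_tests Torus S" and cT: "continuous_on_tests Torus T"
      using S T Torus by (auto simp: distributions_def)
    obtain C N where C: "\<And>\<phi> B. \<phi> \<in> test_functions Torus \<Longrightarrow>
        \<forall>vs\<in>lists Basis. length vs \<le> N \<longrightarrow> (\<forall>x. \<bar>iter_deriv vs \<phi> x\<bar> \<le> B) \<Longrightarrow> \<bar>S \<phi>\<bar> \<le> C * B"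
      using cS unfolding continuous_on_tests.simps by meson
    obtain C' N' where C': "\<And>\<phi> B. \<phi> \<in> test_functions Torus \<Longrightarrow>
        \<forall>vs\<in>lists Basis. length vs \<le> N' \<longrightarrow> (\<forall>x. \<bar>iter_deriv vs \<phi> x\<bar> \<le> B) \<Longrightarrow> \<bar>T \<phi>\<bar> \<le> C' * B"
      using cT unfolding continuous_on_tests.simps by meson
    have "\<forall>\<phi>\<in>test_functions Torus. \<forall>B.
        (\<forall>vs\<in>lists Basis. length vs \<le> max N N' \<longrightarrow> (\<forall>x. \<bar>iter_deriv vs \<phi> x\<bar> \<le> B))
          \<longrightarrow> \<bar>S \<phi> - T \<phi>\<bar> \<le> (C + C') * B"
      by (intro ballI allI impI sum C C') auto
    then show ?thesis using Torus by auto
  next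
    case (Domain U)
    show ?thesis unfolding Domain continuous_on_tests.simps
    proof (intro allI impI)
      fix K assume K: "compact K \<and> K \<subseteq> U"
      obtain C N where C: "\<And>\<phi> B. \<phi> \<in> test_functions (Domain U) \<Longrightarrow> supp \<phi> \<subseteq> K \<Longrightarrow>
          \<forall>vs\<in>lists Basis. length vs \<le> N \<longrightarrow> (\<forall>x. \<bar>iter_deriv vs \<phi> x\<bar> \<le> B) \<Longrightarrow> \<bar>S \<phi>\<bar> \<le> C * B"
        using S Domain K unfolding distributions_def by simp meson
      obtain C' N' where C': "\<And>\<phi> B. \<phi> \<in> test_functions (Domain U) \<Longrightarrow> supp \<phi> \<subseteq> K \<Longrightarrow>
          \<forall>vs\<in>lists Basis. length vs \<le> N' \<longrightarrow> (\<forall>x. \<bar>iter_deriv vs \<phi> x\<bar> \<le> B) \<Longrightarrow> \<bar>T \<phi>\<bar> \<le> C' * B"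
        using T Domain K unfolding distributions_def by simp meson
      have "\<forall>\<phi>\<in>test_functions (Domain U). supp \<phi> \<subseteq> K \<longrightarrow> (\<forall>B.
          (\<forall>vs\<in>lists Basis. length vs \<le> max N N' \<longrightarrow> (\<forall>x. \<bar>iter_deriv vs \<phi> x\<bar> \<le> B))
            \<longrightarrow> \<bar>S \<phi> - T \<phi>\<bar> \<le> (C + C') * B)"
        by (intro ballI allI impI sum C C') auto
      then show "\<exists>C N. \<forall>\<phi>\<in>test_functions (Domain U). supp \<phi> \<subseteq> K \<longrightarrow> (\<forall>B.
          (\<forall>vs\<in>lists Basis. length vs \<le> N \<longrightarrow> (\<forall>x. \<bar>iter_deriv vs \<phi> x\<bar> \<le> B))
            \<longrightarrow> \<bar>S \<phi> - T \<phi>\<bar> \<le> C * B)" by blast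
    qed
  qed
  show ?thesis using lin cont restr by (simp add: distributions_def)
qed

text \<open>Finiteness of the norm of the difference is a premise; in the application the
  interpolation inequality supplies it.\<close>

lemma Bd2_diff:
  assumes adm: "admissible \<Omega>" and g: "g \<in> Bd2 \<Omega> p" and h: "h \<in> Bd2 \<Omega> p"
    and fin: "Bd2_norm \<Omega> p (g - h) < \<infinity>"
  shows "g - h \<in> Bd2 \<Omega> p"
proof -
  have gh: "g \<in> L2_space \<Omega>" "h \<in> L2_space \<Omega>" using g h by (auto simp: Bd2_def)
  have "regular_distr \<Omega> (g - h) \<in> distributions \<Omega>"
    unfolding regular_distr_diff[OF adm gh] using g h
    by (intro distributions_diff) (auto simp: Bd2_def besov_def)
  then show ?thesis using L2_space_diff[OF gh] fin by (simp add: Bd2_def besov_def Bd2_norm_def)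
qed

text \<open>Comparing two values of the Tikhonov functional produces a difference of pairings,
  whereas \<open>err\<close> pairs with a difference. On the torus, integrability of the block
  products and summability of both series justify the splitting; on a domain it is linearity in
  \<open>dual_space\<close>.\<close>

lemma noise_pairing_diff:
  fixes Z :: "'n::finite distr"
  assumes adm: "admissible \<Omega>" and p: "1 < p" and Z: "Z \<in> noise_space \<Omega> p"
    and g: "g \<in> Bd2 \<Omega> p" and h: "h \<in> Bd2 \<Omega> p"
  shows "noise_pairing \<Omega> Z (g - h) = noise_pairing \<Omega> Z g - noise_pairing \<Omega> Z h"
proof (cases \<Omega>)
  case Torus
  have gh: "g \<in> L2_space Torus" "h \<in> L2_space Torus" using g h Torus by (auto simp: Bd2_def)
  have T: "besov_norm Torus (real CARD('n) / 2) (ennreal p) 1 (regular_distr Torus g) < \<infinity>"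
      "besov_norm Torus (real CARD('n) / 2) (ennreal p) 1 (regular_distr Torus h) < \<infinity>"
    using Bd2_norm_finite[OF g] Bd2_norm_finite[OF h] Torus by (simp_all add: Bd2_norm_def)
  have Z1: "besov_norm Torus (- (real CARD('n) / 2)) (ennreal (p / (p - 1))) \<infinity> Z < \<infinity>"
    using Z Torus by (simp add: besov_def)
  note tg = torus_pairing[OF p Z1 T(1)] and th = torus_pairing[OF p Z1 T(2)]
  have "L2_inner Torus (block_torus i Z) (block_torus j (regular_distr Torus (g - h))) =
      L2_inner Torus (block_torus i Z) (block_torus j (regular_distr Torus g)) -
      L2_inner Torus (block_torus i Z) (block_torus j (regular_distr Torus h))" for i j
    using tg(1)[of i j] th(1)[of i j]
    by (simp add: L2_inner_def regular_distr_diff[OF _ gh] block_torus_diff right_diff_distrib)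
  then show ?thesis
    using suminf_diff[OF tg(2) th(2)] Torus by (simp add: sum_subtractf)
next
  case (Domain U)
  then have "linear_functional_on (Bd2 \<Omega> p) Z" using Z by (simp add: dual_space_def)
  then have "Z (\<lambda>x. 1 * g x + (-1) * h x) = 1 * Z g + (-1) * Z h"
    using g h unfolding linear_functional_on_def by blast
  moreover have "g - h = (\<lambda>x. 1 * g x + (-1) * h x)" by auto
  ultimately show ?thesis using Domain by simp
qed

section \<open>Convergence rates\<close>

text \<open>Here \<open>a\<close> is the distance in the image space, \<open>e\<close> the effective
  noise and \<open>\<phi>\<close> the value of \<open>phi_index\<close>. Unless
  \<open>\<alpha> * \<phi>\<close> dominates, \<open>a\<close> is controlled by \<open>e\<close>,
  and the resulting inequality is sublinear in \<open>e\<close>.\<close>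

lemma effective_noise_dichotomy:
  fixes a e M \<alpha> \<beta> \<phi> :: real
  assumes \<beta>: "0 < \<beta>" "\<beta> < 2" and M: "0 \<le> M" and a: "0 \<le> a"
    and e: "e \<le> M * a powr \<beta>" and a_le: "a\<^sup>2 / 4 \<le> e + \<alpha> * \<phi>" and "0 \<le> \<alpha> * \<phi>"
  shows "e \<le> \<alpha> * \<phi> \<or> e \<le> (8 powr (\<beta> / 2) * M) powr (2 / (2 - \<beta>))"
proof (rule disjCI)
  assume "\<not> e \<le> (8 powr (\<beta> / 2) * M) powr (2 / (2 - \<beta>))"
  then have less: "(8 powr (\<beta> / 2) * M) powr (2 / (2 - \<beta>)) < e" by simp
  show "e \<le> \<alpha> * \<phi>"
  proof (rule ccontr)
    assume "\<not> e \<le> \<alpha> * \<phi>"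
    \<comment> \<open>The 8 arises from \<open>a\<^sup>2 \<le> 4 * (e + \<alpha> * \<phi>)\<close>
      and \<open>\<alpha> * \<phi> < e\<close>.\<close>
    then have e0: "0 < e" and "a\<^sup>2 \<le> 8 * e" using a_le \<open>0 \<le> \<alpha> * \<phi>\<close> by auto
    then have "(a\<^sup>2) powr (\<beta> / 2) \<le> (8 * e) powr (\<beta> / 2)" using \<beta> by (intro powr_mono2) auto
    moreover have "(a\<^sup>2) powr (\<beta> / 2) = a powr \<beta>"
      using a \<beta> by (cases "a = 0") (auto simp: powr_powr simp flip: powr_numeral)
    ultimately have "a powr \<beta> \<le> 8 powr (\<beta> / 2) * e powr (\<beta> / 2)" using e0 by (simp add: powr_mult)
    then have "M * a powr \<beta> \<le> M * (8 powr (\<beta> / 2) * e powr (\<beta> / 2))" using M by (rule mult_left_mono)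
    then have "e \<le> (8 powr (\<beta> / 2) * M) * e powr (\<beta> / 2)" using e by (simp add: mult_ac)
    then have "e / e powr (\<beta> / 2) \<le> 8 powr (\<beta> / 2) * M" using e0 by (simp add: divide_le_eq)
    \<comment> \<open>The remaining exponent is positive since \<open>\<beta> < 2\<close>, so
      raising to its reciprocal isolates \<open>e\<close>.\<close>
    moreover have "e / e powr (\<beta> / 2) = e powr ((2 - \<beta>) / 2)"
      using e0 powr_diff[of e 1 "\<beta> / 2"] by (simp add: diff_divide_distrib)
    ultimately have "(e powr ((2 - \<beta>) / 2)) powr (2 / (2 - \<beta>)) \<le> (8 powr (\<beta> / 2) * M) powr (2 / (2 - \<beta>))"
      using \<beta> by (intro powr_mono2) auto
    moreover have "(e powr ((2 - \<beta>) / 2)) powr (2 / (2 - \<beta>)) = e"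
    proof -
      have "(2 - \<beta>) / 2 * (2 / (2 - \<beta>)) = 1" using \<beta> by simp
      then show ?thesis using e0 by (simp only: powr_powr) simp
    qed
    ultimately show False using less by simp
  qed
qed

text \<open>The same absorption, now in \<open>\<Delta>\<close>: the upper bound on
  \<open>\<gamma>\<close> makes the exponent \<open>2 * \<gamma> / (2 - \<beta>)\<close> smaller
  than 1.\<close>

lemma bregman_rate:
  fixes e B N \<alpha> \<beta> \<gamma> \<Delta> \<phi> :: real
  assumes \<beta>: "\<beta> < 2" and \<gamma>: "0 < \<gamma>" "\<gamma> < 1 / 2 * (2 - \<beta>)"
    and B: "0 < B" and N: "0 \<le> N" and \<alpha>: "0 < \<alpha>" and \<Delta>: "0 \<le> \<Delta>" and \<phi>: "0 \<le> \<phi>"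
    and \<Delta>_le: "\<alpha> * \<Delta> / 2 \<le> e + \<alpha> * \<phi>"
    and e: "e \<le> \<alpha> * \<phi> \<or> e \<le> B * N powr (2 / (2 - \<beta>)) * \<Delta> powr (2 * \<gamma> / (2 - \<beta>))"
  shows "\<Delta> / 2 \<le> (4 * B) powr ((2 - \<beta>) / (2 - \<beta> - 2 * \<gamma>)) * \<alpha> powr (- ((2 - \<beta>) / (2 - \<beta> - 2 * \<gamma>))) *
    N powr (2 / (2 - \<beta> - 2 * \<gamma>)) + 4 * \<phi>" (is "_ \<le> ?P + _")
proof -
  have P0: "0 \<le> ?P" by simp
  \<comment> \<open>\<open>\<Delta> = 0\<close> is set apart because the last case divides by
    \<open>\<Delta> powr r\<close>.\<close>
  consider (small) "e \<le> \<alpha> * \<phi>" | (zero) "\<Delta> = 0" | (large) "\<alpha> * \<phi> < e" "0 < \<Delta>" using \<Delta> by linarith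
  then show ?thesis
  proof cases
    case small
    then have "\<alpha> * (\<Delta> / 2) \<le> \<alpha> * (2 * \<phi>)" using \<Delta>_le by simp
    then have "\<Delta> / 2 \<le> 2 * \<phi>" using \<alpha> by simp
    then show ?thesis using P0 \<phi> by linarith
  next
    case zero
    then show ?thesis using P0 \<phi> by simp
  next
    case large
    \<comment> \<open>\<open>k\<close> is the reciprocal of \<open>1 - r\<close>, the exponent left
      after collecting the powers of \<open>\<Delta>\<close>.\<close>
    define k where "k = (2 - \<beta>) / (2 - \<beta> - 2 * \<gamma>)"
    define r where "r = 2 * \<gamma> / (2 - \<beta>)"
    have k: "0 < k" "(1 - r) * k = 1" "2 / (2 - \<beta>) * k = 2 / (2 - \<beta> - 2 * \<gamma>)"
    proof -
      have "1 - r = (2 - \<beta> - 2 * \<gamma>) / (2 - \<beta>)"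
        using \<beta> by (simp add: r_def diff_divide_distrib)
      then show "0 < k" "(1 - r) * k = 1" using \<beta> \<gamma> by (auto simp: k_def)
      have "2 / d * (d / m) = 2 / m" if "d \<noteq> 0" for d m :: real using that by simp
      from this[of "2 - \<beta>"] show "2 / (2 - \<beta>) * k = 2 / (2 - \<beta> - 2 * \<gamma>)"
        using \<beta> unfolding k_def by simp
    qed
    \<comment> \<open>Here \<open>e + \<alpha> * \<phi> \<le> 2 * e\<close>; this 2 and the one in
      \<open>\<Delta> / 2\<close> make up the 4 in \<open>4 * B\<close>.\<close>
    have "\<alpha> * \<Delta> / 2 \<le> 2 * (B * N powr (2 / (2 - \<beta>)) * \<Delta> powr r)"
      using large \<Delta>_le e by (auto simp: r_def)
    then have "\<Delta> / \<Delta> powr r \<le> 4 * B * N powr (2 / (2 - \<beta>)) / \<alpha>"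
      using \<alpha> large by (simp add: field_simps)
    moreover have "\<Delta> / \<Delta> powr r = \<Delta> powr (1 - r)" using large by (simp add: powr_diff)
    ultimately have "(\<Delta> powr (1 - r)) powr k \<le> (4 * B * N powr (2 / (2 - \<beta>)) / \<alpha>) powr k"
      using k(1) by (intro powr_mono2) auto
    then have "\<Delta> \<le> (4 * B * N powr (2 / (2 - \<beta>)) / \<alpha>) powr k"
      using large by (simp add: powr_powr k(2))
    also have "\<dots> = (4 * B) powr k * \<alpha> powr (- k) * N powr (2 / (2 - \<beta> - 2 * \<gamma>))"
    proof -
      have "(N powr (2 / (2 - \<beta>))) powr k = N powr (2 / (2 - \<beta> - 2 * \<gamma>))"
        by (simp only: powr_powr k(3))
      then show ?thesis using B \<alpha> by (simp add: powr_divide powr_mult powr_minus inverse_powr divide_inverse mult_ac)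
    qed
    finally have "\<Delta> \<le> ?P" by (simp add: k_def)
    then show ?thesis using \<Delta> \<phi> by linarith
  qed
qed

theorem theorem2p6:
  fixes \<Omega> :: "(real^'n) region"
    and s :: real and p\<^sub>X q\<^sub>X :: ennreal
    and X D :: "'n distr set" and nrmX :: "'n distr \<Rightarrow> ennreal"
    and F :: "'n distr \<Rightarrow> real^'n \<Rightarrow> real"
    and R :: "'n distr \<Rightarrow> ereal"
    and fdag :: "'n distr" and fstar :: "'n distr \<Rightarrow> real"
    and p C\<^sub>0 \<beta> \<gamma> :: real and \<psi> :: "real \<Rightarrow> real"
  assumes "admissible \<Omega>"
    and "1 \<le> p\<^sub>X" and "1 \<le> q\<^sub>X"
    and X_def: "X = besov \<Omega> s p\<^sub>X q\<^sub>X" and nrmX_def: "nrmX = besov_norm \<Omega> s p\<^sub>X q\<^sub>X"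
    and "1 < p" and "p \<le> 2"
    and "D \<noteq> {}" and "closed_subset X nrmX D" and "convex_subset D"
    and "\<forall>f\<in>D. F f \<in> Bd2 \<Omega> p"
    and "convex_functional X R" and "differentiable_functional X nrmX R"
    and "fdag \<in> D" and "fstar \<in> subdifferential X nrmX R fdag"
    and "concave_index_function \<psi>"
    and variational_source_condition:
      "\<forall>f\<in>D. ereal (fstar (fdag - f)) \<le>
         ereal (1/2) * bregman R fstar f fdag + ereal (\<psi> ((L2_nrm \<Omega> (F fdag - F f))\<^sup>2))"
    and "0 < C\<^sub>0" and "0 < \<beta>" and "0 < \<gamma>"
    and interpolation:
      "\<forall>f\<^sub>1\<in>D. \<forall>f\<^sub>2\<in>D. \<forall>hs\<in>subdifferential X nrmX R f\<^sub>2. R f\<^sub>1 < \<infinity> \<longrightarrow>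
         Bd2_norm \<Omega> p (F f\<^sub>1 - F f\<^sub>2) \<le>
           ennreal (C\<^sub>0 * L2_nrm \<Omega> (F f\<^sub>1 - F f\<^sub>2) powr \<beta> *
             real_of_ereal (bregman R hs f\<^sub>1 f\<^sub>2) powr \<gamma>)"
  shows "\<exists>C>0. \<forall>(M :: 'w measure) Z. random_distribution \<Omega> M Z \<longrightarrow>
    (\<forall>\<omega>\<in>space M. Z \<omega> \<in> noise_space \<Omega> p \<longrightarrow>
      (\<forall>\<epsilon>>0. \<forall>\<alpha>>0. \<forall>fhat.
        is_arg_min (tikhonov \<Omega> F R \<alpha> (observed_data \<Omega> (F fdag) \<epsilon> (Z \<omega>))) (\<lambda>f. f \<in> D) fhat \<longrightarrow>
        (\<beta> < 2 \<longrightarrow>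
          ereal (err \<Omega> (F fdag) \<epsilon> (Z \<omega>) (F fhat)) \<le>
            ereal (C * enn2real (noise_norm \<Omega> p (\<lambda>\<phi>. \<epsilon> * Z \<omega> \<phi>)) powr (2 / (2 - \<beta>)) *
              real_of_ereal (bregman R fstar fhat fdag) powr (2 * \<gamma> / (2 - \<beta>)))
            + ereal (2 * \<alpha>) * phi_index \<psi> (4 * \<alpha>)) \<and>
        (\<beta> < 2 \<and> \<gamma> < 1/2 * (2 - \<beta>) \<longrightarrow>
          ereal (1/2) * bregman R fstar fhat fdag \<le>
            ereal (C * \<alpha> powr (- ((2 - \<beta>) / (2 - \<beta> - 2 * \<gamma>))) *
              enn2real (noise_norm \<Omega> p (\<lambda>\<phi>. \<epsilon> * Z \<omega> \<phi>)) powr (2 / (2 - \<beta> - 2 * \<gamma>)))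
            + 4 * phi_index \<psi> (4 * \<alpha>))))"
proof -
  \<comment> \<open>\<open>L\<close> collects the factors from the dichotomy, the duality estimate
    and the interpolation inequality. \<open>C1\<close> serves the first bound, \<open>C2\<close>
    the second, and \<open>C1 + C2\<close> both; they are positive for every exponent, so
    \<open>\<beta> < 2\<close> can be assumed later.\<close>
  define L where "L = 8 powr (\<beta> / 2) * (3 * 2 powr (real CARD('n) / 2) * C\<^sub>0)"
  define C1 where "C1 = L powr (2 / (2 - \<beta>))"
  define C2 where "C2 = (4 * C1) powr ((2 - \<beta>) / (2 - \<beta> - 2 * \<gamma>))"
  have L0: "0 < L" using \<open>0 < C\<^sub>0\<close> by (simp add: L_def)
  then have C1: "0 < C1" by (simp add: C1_def)
  then have C2: "0 < C2" by (simp add: C2_def)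
  have DX: "D \<subseteq> X" using \<open>closed_subset X nrmX D\<close> by (simp add: closed_subset_def)
  have sub: "fstar \<in> dual_space X nrmX" "\<bar>R fdag\<bar> \<noteq> \<infinity>"
      "\<And>f. f \<in> X \<Longrightarrow> R fdag + ereal (fstar (f - fdag)) \<le> R f"
    using \<open>fstar \<in> subdifferential X nrmX R fdag\<close> by (auto simp: subdifferential_def)
  obtain r0 where r0: "R fdag = ereal r0" using sub(2) by auto
  have psi0: "\<psi> 0 = 0" using \<open>concave_index_function \<psi>\<close> by (simp add: concave_index_function_def)
  \<comment> \<open>The claim is made for each realization separately, so it is proved for one fixed
    functional \<open>Z\<close>.\<close>
  have main: "(\<beta> < 2 \<longrightarrow>
          ereal (err \<Omega> (F fdag) \<epsilon> Z (F fhat)) \<le>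
            ereal ((C1 + C2) * enn2real (noise_norm \<Omega> p (\<lambda>\<phi>. \<epsilon> * Z \<phi>)) powr (2 / (2 - \<beta>)) *
              real_of_ereal (bregman R fstar fhat fdag) powr (2 * \<gamma> / (2 - \<beta>)))
            + ereal (2 * \<alpha>) * phi_index \<psi> (4 * \<alpha>)) \<and>
        (\<beta> < 2 \<and> \<gamma> < 1/2 * (2 - \<beta>) \<longrightarrow>
          ereal (1/2) * bregman R fstar fhat fdag \<le>
            ereal ((C1 + C2) * \<alpha> powr (- ((2 - \<beta>) / (2 - \<beta> - 2 * \<gamma>))) *
              enn2real (noise_norm \<Omega> p (\<lambda>\<phi>. \<epsilon> * Z \<phi>)) powr (2 / (2 - \<beta> - 2 * \<gamma>)))
            + 4 * phi_index \<psi> (4 * \<alpha>))"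
    if Z: "Z \<in> noise_space \<Omega> p" and \<epsilon>: "0 < \<epsilon>" and \<alpha>: "0 < \<alpha>"
      and argmin: "is_arg_min (tikhonov \<Omega> F R \<alpha> (observed_data \<Omega> (F fdag) \<epsilon> Z)) (\<lambda>f. f \<in> D) fhat"
    for Z :: "'n distr" and \<epsilon> \<alpha> fhat
  proof -
    define T where "T = tikhonov \<Omega> F R \<alpha> (observed_data \<Omega> (F fdag) \<epsilon> Z)"
    define N where "N = enn2real (noise_norm \<Omega> p (\<lambda>\<phi>. \<epsilon> * Z \<phi>))"
    define a where "a = L2_nrm \<Omega> (F fhat - F fdag)"
    define e where "e = err \<Omega> (F fdag) \<epsilon> Z (F fhat)"
    have N0: "0 \<le> N" and a0: "0 \<le> a" by (auto simp: N_def a_def L2_nrm_nonneg)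
    have fhat: "fhat \<in> D" and min: "T fhat \<le> T fdag"
      using argmin \<open>fdag \<in> D\<close> by (auto simp: is_arg_min_linorder T_def)
    have X: "fhat \<in> X" "fdag \<in> X" using fhat \<open>fdag \<in> D\<close> DX by auto
    have B: "F fhat \<in> Bd2 \<Omega> p" "F fdag \<in> Bd2 \<Omega> p"
      using fhat \<open>fdag \<in> D\<close> \<open>\<forall>f\<in>D. F f \<in> Bd2 \<Omega> p\<close> by auto
    then have L2: "F fhat \<in> L2_space \<Omega>" "F fdag \<in> L2_space \<Omega>" by (auto simp: Bd2_def)
    have "R fhat \<noteq> -\<infinity>" using \<open>convex_functional X R\<close> X by (simp add: convex_functional_def)
    \<comment> \<open>The functional is finite at \<open>fdag\<close>, so a minimizer cannot have
      infinite penalty.\<close>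
    moreover have "R fhat \<noteq> \<infinity>"
      using min \<alpha> by (auto simp: T_def tikhonov_def r0)
    ultimately obtain r1 where r1: "R fhat = ereal r1" by (cases "R fhat") auto
    define \<Delta> where "\<Delta> = r1 - r0 - fstar (fhat - fdag)"
    have breg: "bregman R fstar fhat fdag = ereal \<Delta>" by (simp add: bregman_def r0 r1 \<Delta>_def)
    have \<Delta>0: "0 \<le> \<Delta>" using sub(3)[OF X(1)] by (simp add: r0 r1 \<Delta>_def)
    have neg: "fstar (fdag - fhat) = - fstar (fhat - fdag)"
    proof -
      have lin: "fstar (\<lambda>x. c * fhat x + d * fdag x) = c * fstar fhat + d * fstar fdag" for c d
        using sub(1) X by (simp add: dual_space_def linear_functional_on_def)
      have "fdag - fhat = (\<lambda>x. (-1) * fhat x + 1 * fdag x)" "fhat - fdag = (\<lambda>x. 1 * fhat x + (-1) * fdag x)"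
        by auto
      then show ?thesis using lin[of "-1" 1] lin[of 1 "-1"] by simp
    qed
    \<comment> \<open>By definition of \<open>\<Delta>\<close> the left side is
      \<open>- \<Delta> - fstar (fhat - fdag)\<close>, and the source condition gives back only half
      of \<open>\<Delta>\<close>.\<close>
    have vsc: "r0 - r1 \<le> - \<Delta> / 2 + \<psi> (a\<^sup>2)"
    proof -
      have "- fstar (fhat - fdag) \<le> \<Delta> / 2 + \<psi> (a\<^sup>2)"
        using variational_source_condition[rule_format, OF fhat]
        by (simp add: breg neg a_def L2_nrm_minus_commute)
      then show ?thesis unfolding \<Delta>_def by argo
    qed
    \<comment> \<open>Up to a common constant, the functional is half the squared distance to
      \<open>F fdag\<close>, minus the noise pairing, plus the penalty; the two noise pairings
      combine to \<open>e\<close>.\<close>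
    have tik: "a\<^sup>2 / 2 \<le> e + \<alpha> * (r0 - r1)"
    proof -
      have pd: "noise_pairing \<Omega> Z (F fhat - F fdag) = noise_pairing \<Omega> Z (F fhat) - noise_pairing \<Omega> Z (F fdag)"
        by (rule noise_pairing_diff[OF \<open>admissible \<Omega>\<close> \<open>1 < p\<close> Z B])
      show ?thesis
        using min unfolding a_def L2_nrm_diff_power2[OF L2]
        by (simp add: T_def tikhonov_def r0 r1 observed_data_def e_def err_def pd L2_nrm_power2 algebra_simps
            add_divide_distrib diff_divide_distrib)
    qed
    have e_le: "e \<le> (3 * 2 powr (real CARD('n) / 2) * C\<^sub>0 * N * \<Delta> powr \<gamma>) * a powr \<beta>"
    proof -
      have le: "Bd2_norm \<Omega> p (F fhat - F fdag) \<le> ennreal (C\<^sub>0 * a powr \<beta> * \<Delta> powr \<gamma>)"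
        using interpolation[rule_format, OF fhat \<open>fdag \<in> D\<close> \<open>fstar \<in> subdifferential X nrmX R fdag\<close>]
        by (simp add: r1 breg a_def)
      \<comment> \<open>Interpolation serves twice: it places the difference in \<open>Bd2\<close>,
        so that the duality estimate applies, and then bounds its norm.\<close>
      then have "Bd2_norm \<Omega> p (F fhat - F fdag) < \<infinity>" by (rule le_less_trans) simp
      then have "F fhat - F fdag \<in> Bd2 \<Omega> p" by (rule Bd2_diff[OF \<open>admissible \<Omega>\<close> B])
      from noise_pairing_bound[OF \<open>1 < p\<close> \<epsilon> Z this]
      have "e \<le> 3 * 2 powr (real CARD('n) / 2) * N * enn2real (Bd2_norm \<Omega> p (F fhat - F fdag))"
        by (simp add: e_def err_def N_def)
      also have "\<dots> \<le> 3 * 2 powr (real CARD('n) / 2) * N * (C\<^sub>0 * a powr \<beta> * \<Delta> powr \<gamma>)"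
        using enn2real_mono[OF le] \<open>0 < C\<^sub>0\<close> N0 by (intro mult_left_mono) auto
      finally show ?thesis by (simp add: mult_ac)
    qed
    \<comment> \<open>Fenchel-Young inequality, used with \<open>u = 0\<close> for nonnegativity and
      with \<open>u = a\<^sup>2\<close> for the source condition.\<close>
    have phi_ge: "ereal (\<psi> u - u / (4 * \<alpha>)) \<le> phi_index \<psi> (4 * \<alpha>)" if "0 \<le> u" for u
      unfolding phi_index_def using that by (intro SUP_upper) simp
    have phi0: "0 \<le> phi_index \<psi> (4 * \<alpha>)" using phi_ge[of 0] by (simp add: psi0 zero_ereal_def)
    show ?thesis
    \<comment> \<open>An infinite value makes both bounds trivial; otherwise all quantities are
      real.\<close>
    proof (cases "phi_index \<psi> (4 * \<alpha>)")
      case PInf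
      then show ?thesis using \<alpha> by (simp add: breg)
    next
      case MInf
      then show ?thesis using phi0 by simp
    next
      case (real \<phi>)
      have \<phi>0: "0 \<le> \<phi>" using phi0 by (simp add: real)
      \<comment> \<open>The argument \<open>4 * \<alpha>\<close> is chosen so that, after
        multiplication by \<open>\<alpha>\<close>, only half of the term
        \<open>a\<^sup>2 / 2\<close> in \<open>tik\<close> is absorbed.\<close>
      have "\<psi> (a\<^sup>2) \<le> \<phi> + a\<^sup>2 / (4 * \<alpha>)" using phi_ge[of "a\<^sup>2"] by (simp add: real)
      then have "\<alpha> * \<psi> (a\<^sup>2) \<le> \<alpha> * (\<phi> + a\<^sup>2 / (4 * \<alpha>))" using \<alpha> by (intro mult_left_mono) auto
      also have "\<dots> = \<alpha> * \<phi> + a\<^sup>2 / 4" using \<alpha> by (simp add: field_simps)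
      finally have \<psi>_le: "\<alpha> * \<psi> (a\<^sup>2) \<le> \<alpha> * \<phi> + a\<^sup>2 / 4" .
      have "\<alpha> * (r0 - r1) \<le> \<alpha> * (- \<Delta> / 2 + \<psi> (a\<^sup>2))" using vsc \<alpha> by (intro mult_left_mono) auto
      also have "\<dots> = - (\<alpha> * \<Delta> / 2) + \<alpha> * \<psi> (a\<^sup>2)" by (simp add: algebra_simps)
      finally have key: "a\<^sup>2 / 4 + \<alpha> * \<Delta> / 2 \<le> e + \<alpha> * \<phi>" using tik \<psi>_le by linarith
      have \<alpha>\<phi>: "0 \<le> \<alpha> * \<phi>" and \<alpha>\<Delta>: "0 \<le> \<alpha> * \<Delta>" using \<alpha> \<phi>0 \<Delta>0 by auto
      \<comment> \<open>This alternative yields the first bound directly and enters the second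
        through \<open>bregman_rate\<close>.\<close>
      have dich: "e \<le> \<alpha> * \<phi> \<or> e \<le> C1 * N powr (2 / (2 - \<beta>)) * \<Delta> powr (2 * \<gamma> / (2 - \<beta>))" if "\<beta> < 2"
      proof -
        let ?M = "3 * 2 powr (real CARD('n) / 2) * C\<^sub>0 * N * \<Delta> powr \<gamma>"
        have "e \<le> \<alpha> * \<phi> \<or> e \<le> (8 powr (\<beta> / 2) * ?M) powr (2 / (2 - \<beta>))"
          using key \<alpha>\<phi> \<alpha>\<Delta> N0 \<open>0 < C\<^sub>0\<close>
          by (intro effective_noise_dichotomy[OF \<open>0 < \<beta>\<close> that _ a0 e_le]) auto
        also have "8 powr (\<beta> / 2) * ?M = L * N * \<Delta> powr \<gamma>" by (simp add: L_def)
        also have "\<dots> powr (2 / (2 - \<beta>)) = C1 * N powr (2 / (2 - \<beta>)) * \<Delta> powr (2 * \<gamma> / (2 - \<beta>))"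
          using L0 N0 by (simp add: C1_def powr_mult powr_powr mult_ac)
        finally show ?thesis .
      qed
      show ?thesis
      proof (intro conjI impI)
        assume \<beta>: "\<beta> < 2"
        let ?P = "N powr (2 / (2 - \<beta>)) * \<Delta> powr (2 * \<gamma> / (2 - \<beta>))"
        \<comment> \<open>Both terms are nonnegative, so either alternative is bounded by their
          sum.\<close>
        have "0 \<le> C1 * ?P" using C1 by (intro mult_nonneg_nonneg) auto
        moreover have "C1 * ?P \<le> (C1 + C2) * ?P" using C2 by (intro mult_right_mono) auto
        ultimately have "e \<le> (C1 + C2) * ?P + 2 * \<alpha> * \<phi>" using dich[OF \<beta>] \<alpha>\<phi> by (auto simp: mult.assoc)
        then show "ereal (err \<Omega> (F fdag) \<epsilon> Z (F fhat)) \<le>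
            ereal ((C1 + C2) * enn2real (noise_norm \<Omega> p (\<lambda>\<phi>. \<epsilon> * Z \<phi>)) powr (2 / (2 - \<beta>)) *
              real_of_ereal (bregman R fstar fhat fdag) powr (2 * \<gamma> / (2 - \<beta>)))
            + ereal (2 * \<alpha>) * phi_index \<psi> (4 * \<alpha>)"
          by (simp add: real breg N_def e_def mult.assoc)
      next
        assume \<beta>\<gamma>: "\<beta> < 2 \<and> \<gamma> < 1/2 * (2 - \<beta>)"
        let ?P = "\<alpha> powr (- ((2 - \<beta>) / (2 - \<beta> - 2 * \<gamma>))) * N powr (2 / (2 - \<beta> - 2 * \<gamma>))"
        have "\<alpha> * \<Delta> / 2 \<le> e + \<alpha> * \<phi>" using key zero_le_power2[of a] by linarith
        then have "\<Delta> / 2 \<le> C2 * ?P + 4 * \<phi>"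
          using bregman_rate[OF _ \<open>0 < \<gamma>\<close> _ C1 N0 \<alpha> \<Delta>0 \<phi>0 _ dich] \<beta>\<gamma> by (simp add: C2_def mult.assoc)
        also have "\<dots> \<le> (C1 + C2) * ?P + 4 * \<phi>"
          using C1 C2 by (intro add_right_mono mult_right_mono) auto
        finally show "ereal (1/2) * bregman R fstar fhat fdag \<le>
            ereal ((C1 + C2) * \<alpha> powr (- ((2 - \<beta>) / (2 - \<beta> - 2 * \<gamma>))) *
              enn2real (noise_norm \<Omega> p (\<lambda>\<phi>. \<epsilon> * Z \<phi>)) powr (2 / (2 - \<beta> - 2 * \<gamma>)))
            + 4 * phi_index \<psi> (4 * \<alpha>)"
          by (simp add: real breg N_def mult.assoc)
      qed
    qed
  qed
  \<comment> \<open>The constant depends only on \<open>\<beta>\<close>, \<open>\<gamma>\<close>,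
    \<open>C\<^sub>0\<close> and the dimension, so it can precede the quantifiers over the noise,
    its level, \<open>\<alpha>\<close> and the minimizer.\<close>
  show ?thesis
    using C1 C2 by (intro exI[of _ "C1 + C2"] conjI allI ballI impI main) auto
qed

end
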